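(* For every fixed integer $k \ge 1$, there are only finitely many (up to isomorphism) $k$-vertex-critical $(P_5,W_4)$-free graphs.
   Context: All graphs are finite, simple and undirected. $P_5$ denotes the path on $5$ vertices and $W_4$ (the $4$-wheel) denotes the graph consisting of a cycle $C_4$ on four vertices plus one additional vertex adjacent to all four vertices of the $C_4$. A graph is $(H_1,H_2)$-free if it contains no induced subgraph isomorphic to $H_1$ and no induced subgraph isomorphic to $H_2$. $\chi(G)$ denotes the chromatic number of $G$. A graph $G$ is $k$-vertex-critical if $\chi(G)=k$ and $\chi(G-v)<k$ for every vertex $v \in V(G)$. *)

theory Defs
  imports "Graph_Theory.Graph_Theory"
begin

text \<open>
  Finite simple undirected graphs are \<open>pair_graph\<close>s: each edge \<open>uv\<close> is represented by the two arcs
  \<open>(u, v)\<close> and \<open>(v, u)\<close>.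
\<close>

definition proper_colouring :: "('a, 'b) pre_digraph \<Rightarrow> nat \<Rightarrow> ('a \<Rightarrow> nat) \<Rightarrow> bool" where
  "proper_colouring G n c \<longleftrightarrow>
     (\<forall>v \<in> verts G. c v < n) \<and> (\<forall>u v. u \<rightarrow>\<^bsub>G\<^esub> v \<longrightarrow> c u \<noteq> c v)"

text \<open>
  The least element exists for every finite graph without loops; the value is \<open>0\<close> exactly when such
  a graph has no vertices.
\<close>

definition chromatic_number :: "('a, 'b) pre_digraph \<Rightarrow> nat" where
  "chromatic_number G = (LEAST n. \<exists>c. proper_colouring G n c)"

definition vertex_critical :: "nat \<Rightarrow> ('a, 'b) pre_digraph \<Rightarrow> bool" where
  "vertex_critical k G \<longleftrightarrow>
     chromatic_number G = k \<and>
     (\<forall>v \<in> verts G. chromatic_number (pre_digraph.del_vert G v) < k)"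

definition induced_free :: "('c, 'd) pre_digraph \<Rightarrow> ('a, 'b) pre_digraph \<Rightarrow> bool" where
  "induced_free H G \<longleftrightarrow> \<not> (\<exists>S. induced_subgraph S G \<and> digraph_iso S H)"

definition path_graph :: "nat \<Rightarrow> nat pair_pre_digraph" where
  "path_graph n = \<lparr>pverts = {..<n},
     parcs = {(i, j). i < n \<and> j < n \<and> (j = Suc i \<or> i = Suc j)}\<rparr>"

definition cycle_graph :: "nat \<Rightarrow> nat pair_pre_digraph" where
  "cycle_graph n = \<lparr>pverts = {..<n},
     parcs = {(i, j). i < n \<and> j < n \<and> (j = Suc i mod n \<or> i = Suc j mod n)}\<rparr>"

text \<open>The rim of the wheel is the cycle on \<open>0, \<dots>, n - 1\<close>, its hub is the vertex \<open>n\<close>.\<close>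

definition wheel_graph :: "nat \<Rightarrow> nat pair_pre_digraph" where
  "wheel_graph n = \<lparr>pverts = insert n (pverts (cycle_graph n)),
     parcs = parcs (cycle_graph n) \<union>
       {n} \<times> pverts (cycle_graph n) \<union> pverts (cycle_graph n) \<times> {n}\<rparr>"

lemma pair_graph_path_graph: "pair_graph (path_graph n)"
proof
  show "finite (parcs (path_graph n))"
    by (rule finite_subset[of _ "{..<n} \<times> {..<n}"]) (auto simp: path_graph_def)
qed (auto simp: path_graph_def symmetric_def intro!: symI)

lemma pair_graph_wheel_graph:
  assumes "n \<ge> 3"
  shows "pair_graph (wheel_graph n)"
proof
  show "finite (parcs (wheel_graph n))"
    by (rule finite_subset[of _ "{..n} \<times> {..n}"]) (auto simp: wheel_graph_def cycle_graph_def)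
  show "symmetric (with_proj (wheel_graph n))"
    by (auto simp: wheel_graph_def cycle_graph_def symmetric_def intro!: symI)
next
  fix e assume "e \<in> parcs (wheel_graph n)"
  moreover have "i \<noteq> Suc i mod n" if "i < n" for i
    using that assms by (cases "Suc i = n") auto
  ultimately show "fst e \<noteq> snd e"
    by (fastforce simp: wheel_graph_def cycle_graph_def)
qed (auto simp: wheel_graph_def cycle_graph_def)

end

theory Submission
  imports Defs "HOL-Library.Ramsey"
begin

text \<open>
  The number of vertices of a \<open>k\<close>-vertex-critical \<open>(P\<^sub>5, W\<^sub>4)\<close>-free graph is bounded in terms of \<open>k\<close>.
  A set \<open>D\<close> of vertices splits the others into classes with the same neighbourhood in \<open>D\<close>; consider the
  components of these classes. By \<open>P\<^sub>5\<close>-freeness, outside vertices from one class that are mixed on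
  distinct components of another class are pairwise adjacent, so few components have mixed vertices.
  The components without mixed vertices, of equal class and equal chromatic number, have pairwise
  incomparable neighbourhoods by criticality. Ramsey's theorem makes the vertices witnessing this
  uniform, and every uniform pattern contains a large clique, an induced \<open>P\<^sub>5\<close> or an induced \<open>W\<^sub>4\<close>.
  Hence the number of components is bounded in terms of \<open>k\<close> and \<open>|D|\<close>.

  A Gyarfas path argument then yields a bounded dominating set inside each component. Adding these
  sets to \<open>D\<close> extends, for every vertex outside \<open>D\<close>, a clique of its neighbours in \<open>D\<close> by one vertex.
  As cliques have at most \<open>k\<close> vertices, after \<open>k\<close> rounds \<open>D\<close> is the whole graph.
\<close>

section \<open>Ramsey's theorem for increasing quadruples\<close>

text \<open>Only increasing quadruples are coloured, and the homogeneous set is given by its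
  increasing enumeration \<open>h\<close>. The order of the indices thus remains available, which is
  essential for the half graphs below.\<close>

definition quad_homogeneous :: "nat \<Rightarrow> nat \<Rightarrow> nat \<Rightarrow> bool" where
  "quad_homogeneous c n N \<longleftrightarrow>
     (\<forall>f :: nat \<Rightarrow> nat \<Rightarrow> nat \<Rightarrow> nat \<Rightarrow> nat.
        (\<forall>i j k l. i < j \<longrightarrow> j < k \<longrightarrow> k < l \<longrightarrow> l < N \<longrightarrow> f i j k l < c) \<longrightarrow>
        (\<exists>h x. strict_mono_on {..<n} h \<and> h ` {..<n} \<subseteq> {..<N} \<and>
           (\<forall>i j k l. i < j \<longrightarrow> j < k \<longrightarrow> k < l \<longrightarrow> l < n \<longrightarrow> f (h i) (h j) (h k) (h l) = x)))"

definition quad_ramsey :: "nat \<Rightarrow> nat \<Rightarrow> nat" where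
  "quad_ramsey c n = (SOME N. quad_homogeneous c n N)"

lemma quad_homogeneous_quad_ramsey: "quad_homogeneous c n (quad_ramsey c n)"
proof -
  obtain N :: nat where N: "partn_lst {..<N} (replicate c n) 4"
    using ramsey_full by blast
  have "quad_homogeneous c n N"
    unfolding quad_homogeneous_def
  proof (intro allI impI)
    fix f :: "nat \<Rightarrow> nat \<Rightarrow> nat \<Rightarrow> nat \<Rightarrow> nat"
    assume f: "\<forall>i j k l. i < j \<longrightarrow> j < k \<longrightarrow> k < l \<longrightarrow> l < N \<longrightarrow> f i j k l < c"
    \<comment> \<open>The partition theorem colours 4-element sets, so a set is coloured by
      \<open>f\<close> applied to its elements in increasing order.\<close>
    define g where
      "g S = (let xs = sorted_list_of_set S in f (xs ! 0) (xs ! 1) (xs ! 2) (xs ! 3))" for S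
    have g: "g {i, j, k, l} = f i j k l" if "i < j" "j < k" "k < l" for i j k l
    proof -
      have "sorted_list_of_set (set [i, j, k, l]) = [i, j, k, l]"
        using that by (intro sorted_list_of_set.idem_if_sorted_distinct) auto
      then show ?thesis
        by (simp add: g_def)
    qed
    have "g \<in> nsets {..<N} 4 \<rightarrow> {..<c}"
      unfolding ordered_nsets_4_eq using f g by auto
    then obtain x where "x < c" "monochromatic {..<N} n 4 g x"
      using N by (auto simp: partn_lst_def)
    then obtain H where H: "H \<in> nsets {..<N} n" "g ` nsets H 4 \<subseteq> {x}"
      by (auto simp: monochromatic_def)
    then have fin: "finite H" and card: "card H = n" and sub: "H \<subseteq> {..<N}"
      by (auto simp: nsets_def)
    define h where "h i = sorted_list_of_set H ! i" for i
    have mono: "strict_mono_on {..<n} h"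
      unfolding h_def using card
      by (intro strict_mono_onI) (simp add: sorted_wrt_nth_less[OF strict_sorted_list_of_set])
    have mem: "h i \<in> H" if "i < n" for i
      using that card fin unfolding h_def
      by (metis nth_mem sorted_list_of_set.length_sorted_key_list_of_set
          sorted_list_of_set.set_sorted_key_list_of_set)
    have "f (h i) (h j) (h k) (h l) = x" if "i < j" "j < k" "k < l" "l < n" for i j k l
    proof -
      have less: "h i < h j" "h j < h k" "h k < h l"
        using that by (auto intro!: strict_mono_onD[OF mono])
      have "{h i, h j, h k, h l} \<in> nsets H 4"
        unfolding ordered_nsets_4_eq using less mem that
        by (intro CollectI exI[of _ "h i"] exI[of _ "h j"] exI[of _ "h k"] exI[of _ "h l"]) auto
      then have "g {h i, h j, h k, h l} = x"
        using H by blast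
      with less show ?thesis
        by (simp add: g)
    qed
    with mono mem sub show "\<exists>h x. strict_mono_on {..<n} h \<and> h ` {..<n} \<subseteq> {..<N} \<and>
           (\<forall>i j k l. i < j \<longrightarrow> j < k \<longrightarrow> k < l \<longrightarrow> l < n \<longrightarrow> f (h i) (h j) (h k) (h l) = x)"
      by blast
  qed
  then show ?thesis
    unfolding quad_ramsey_def by (rule someI)
qed

text \<open>An arbitrary finite set of colours is numbered by a bijection \<open>e\<close>; its
  injectivity turns equal numbers back into equal colours.\<close>

lemma quad_ramseyE:
  fixes f :: "nat \<Rightarrow> nat \<Rightarrow> nat \<Rightarrow> nat \<Rightarrow> 'c"
  assumes "finite C" "card C \<le> c" "quad_ramsey c n \<le> N"
    and f: "\<And>i j k l. i < j \<Longrightarrow> j < k \<Longrightarrow> k < l \<Longrightarrow> l < N \<Longrightarrow> f i j k l \<in> C"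
  obtains h x where "strict_mono_on {..<n} h" "\<And>i. i < n \<Longrightarrow> h i < N"
    "\<And>i j k l. i < j \<Longrightarrow> j < k \<Longrightarrow> k < l \<Longrightarrow> l < n \<Longrightarrow> f (h i) (h j) (h k) (h l) = x"
proof -
  obtain e where e: "bij_betw e C {0..<card C}"
    using ex_bij_betw_finite_nat[OF \<open>finite C\<close>] by blast
  have "e y < c" if "y \<in> C" for y
    using bij_betwE[OF e] that assms(2) by fastforce
  then have "\<forall>i j k l. i < j \<longrightarrow> j < k \<longrightarrow> k < l \<longrightarrow> l < quad_ramsey c n \<longrightarrow> e (f i j k l) < c"
    using order.strict_trans2[OF _ assms(3)] f by presburger
  from mp[OF spec[OF quad_homogeneous_quad_ramsey[of c n, unfolded quad_homogeneous_def],
        of "\<lambda>i j k l. e (f i j k l)"] this]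
  obtain h x where h: "strict_mono_on {..<n} h" "h ` {..<n} \<subseteq> {..<quad_ramsey c n}"
    "\<forall>i j k l. i < j \<longrightarrow> j < k \<longrightarrow> k < l \<longrightarrow> l < n \<longrightarrow> e (f (h i) (h j) (h k) (h l)) = x"
    by (elim exE conjE) (rule that; assumption)
  then have less: "h i < N" if "i < n" for i
    using that assms(3) by (meson image_subset_iff lessThan_iff order.strict_trans2)
  have "f (h i) (h j) (h k) (h l) = the_inv_into C e x"
    if "i < j" "j < k" "k < l" "l < n" for i j k l
  proof -
    have "h i < h j" "h j < h k" "h k < h l"
      using that by (auto intro!: strict_mono_onD[OF h(1)])
    then have "f (h i) (h j) (h k) (h l) \<in> C"
      using f less that by blast
    then show ?thesis
      using h(3) that e by (metis bij_betw_def the_inv_into_f_f)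
  qed
  with h(1) less that show ?thesis
    by blast
qed

section \<open>Critical graphs without induced \<open>P\<^sub>5\<close> and \<open>W\<^sub>4\<close>\<close>

lemma rtranclp_leaveE:
  assumes "r\<^sup>*\<^sup>* x y" "P x" "\<not> P y"
  obtains z z' where "r\<^sup>*\<^sup>* x z" "r z z'" "P z" "\<not> P z'"
proof -
  have "\<exists>z z'. r\<^sup>*\<^sup>* x z \<and> r z z' \<and> P z \<and> \<not> P z'"
    using assms by (induction rule: rtranclp_induct) blast+
  with that show ?thesis
    by blast
qed

text \<open>A relation together with a vertex set lets one edge relation serve all induced
  subgraphs.\<close>

definition colourable :: "('a \<Rightarrow> 'a \<Rightarrow> bool) \<Rightarrow> 'a set \<Rightarrow> nat \<Rightarrow> bool" where
  "colourable E A n \<longleftrightarrow>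
     (\<exists>c. (\<forall>v\<in>A. c v < n) \<and> (\<forall>u\<in>A. \<forall>v\<in>A. E u v \<longrightarrow> c u \<noteq> c v))"

text \<open>Here \<open>q\<close> stands for k - 1. In \<open>P5\<close> the distinctness of the
  five vertices follows from the listed edges and non-edges; in \<open>W4\<close> it has to be
  demanded for the two diagonals.\<close>

locale critical_P5_W4_free =
  fixes V :: "'a set" and E :: "'a \<Rightarrow> 'a \<Rightarrow> bool" and q :: nat
  assumes finite_V: "finite V"
    and edge_V: "E x y \<Longrightarrow> x \<in> V"
    and sym: "E x y \<Longrightarrow> E y x"
    and irrefl: "\<not> E x x"
    and P5: "\<lbrakk>E a b; E b c; E c d; E d e; \<not> E a c; \<not> E a d; \<not> E a e; \<not> E b d; \<not> E b e; \<not> E c e\<rbrakk>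
               \<Longrightarrow> False"
    and W4: "\<lbrakk>E a b; E b c; E c d; E d a; \<not> E a c; \<not> E b d; a \<noteq> c; b \<noteq> d; E h a; E h b; E h c; E h d\<rbrakk>
               \<Longrightarrow> False"
    and not_colourable: "\<not> colourable E V q"
    and colourable_remove: "x \<in> V \<Longrightarrow> colourable E (V - {x}) q"
begin

lemma sym_iff: "E x y \<longleftrightarrow> E y x"
  using sym by blast

subsection \<open>Classes and their components\<close>

definition trace :: "'a set \<Rightarrow> 'a \<Rightarrow> 'a set" where
  "trace D x = {d \<in> D. E d x}"

definition step :: "'a set \<Rightarrow> 'a \<Rightarrow> 'a \<Rightarrow> bool" where
  "step D x y \<longleftrightarrow> E x y \<and> x \<notin> D \<and> y \<notin> D \<and> trace D x = trace D y"

text \<open>Since \<open>step\<close> avoids \<open>D\<close>, a vertex of \<open>D\<close> has only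
  itself in its component; hence the recurring hypothesis that the base vertex lies outside
  \<open>D\<close>.\<close>

definition component :: "'a set \<Rightarrow> 'a \<Rightarrow> 'a set" where
  "component D x = {y. (step D)\<^sup>*\<^sup>* x y}"

definition components :: "'a set \<Rightarrow> 'a set set" where
  "components D = component D ` (V - D)"

definition mixed :: "'a set \<Rightarrow> 'a \<Rightarrow> bool" where
  "mixed K v \<longleftrightarrow> v \<notin> K \<and> (\<exists>x\<in>K. E v x) \<and> (\<exists>y\<in>K. \<not> E v y)"

lemma trace_eqD: "trace D x = trace D y \<Longrightarrow> d \<in> D \<Longrightarrow> E d x \<Longrightarrow> E d y"
  by (auto simp: trace_def)

text \<open>A vertex \<open>d\<close> of \<open>D\<close> that separates the two traces is adjacent
  to exactly one of the pairs \<open>x\<close>, \<open>x'\<close> and \<open>y\<close>,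
  \<open>y'\<close>. It joins the two independent edges to an induced path on five vertices with
  \<open>d\<close> in the middle.\<close>

lemma crossing:
  assumes "trace D x = trace D x'" "trace D y = trace D y'" "trace D x \<noteq> trace D y"
    and "E x y" "E x' y'" "\<not> E x x'" "\<not> E y y'" "\<not> E x y'" "\<not> E x' y"
  shows False
proof -
  obtain d where d: "d \<in> D" "E d x \<noteq> E d y"
    using assms(3) by (auto simp: trace_def)
  then have d': "E d x' = E d x" "E d y' = E d y"
    using assms(1,2) by (auto simp: trace_def)
  show False
  proof (cases "E d x")
    case True
    then show False
      using P5[of y x d x' y'] d d' assms sym_iff by blast
  next
    case False
    then show False
      using P5[of x y d y' x'] d d' assms sym_iff by blast
  qed
qed

lemma self_in_component: "x \<in> component D x"
  by (simp add: component_def)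

lemma step_sym: "step D x y \<Longrightarrow> step D y x"
  by (auto simp: step_def sym)

lemma component_trace: "y \<in> component D x \<Longrightarrow> trace D y = trace D x"
  unfolding component_def mem_Collect_eq
  by (induction rule: rtranclp_induct) (auto simp: step_def)

lemma component_notin: "y \<in> component D x \<Longrightarrow> x \<notin> D \<Longrightarrow> y \<notin> D"
  unfolding component_def mem_Collect_eq
  by (induction rule: rtranclp_induct) (auto simp: step_def)

lemma component_V: "y \<in> component D x \<Longrightarrow> x \<in> V \<Longrightarrow> y \<in> V"
  unfolding component_def mem_Collect_eq
  by (induction rule: rtranclp_induct) (auto simp: step_def dest: sym edge_V)

lemma rtranclp_step_sym: "(step D)\<^sup>*\<^sup>* x y \<Longrightarrow> (step D)\<^sup>*\<^sup>* y x"
  by (induction rule: rtranclp_induct) (auto dest: step_sym intro: converse_rtranclp_into_rtranclp)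

lemma component_eq: "y \<in> component D x \<Longrightarrow> component D y = component D x"
  unfolding component_def by (auto intro: rtranclp_trans dest: rtranclp_step_sym)

lemma component_extend:
  assumes "y \<in> component D x" "x \<notin> D" "E y z" "z \<notin> D" "trace D z = trace D x"
  shows "z \<in> component D x"
proof -
  have "step D y z"
    using assms component_notin[OF assms(1,2)] component_trace[OF assms(1)] by (simp add: step_def)
  with assms(1) show ?thesis
    by (auto simp: component_def)
qed

lemma component_anticomplete:
  assumes "y \<in> component D x" "y' \<in> component D x'" "x \<notin> D" "x' \<notin> D" "trace D x = trace D x'"
    and "component D x \<noteq> component D x'"
  shows "\<not> E y y'"
proof
  assume "E y y'"
  then have "y' \<in> component D x"
    using component_extend[OF assms(1,3) _ component_notin[OF assms(2,4)]] component_trace[OF assms(2)]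
      assms(5) by simp
  then show False
    using component_eq[OF assms(2)] component_eq assms(6) by blast
qed

lemma components_finite: "finite (components D)"
  by (simp add: components_def finite_V)

lemma component_finite: "x \<in> V \<Longrightarrow> finite (component D x)"
  by (rule finite_subset[OF _ finite_V]) (auto dest: component_V)

lemma component_boundary_edge:
  assumes "z \<in> component D x" "y \<in> component D x" "P z" "\<not> P y"
  obtains x' y' where "x' \<in> component D x" "y' \<in> component D x" "step D x' y'" "P x'" "\<not> P y'"
proof -
  have "(step D)\<^sup>*\<^sup>* z y"
    using assms by (metis component_def component_eq mem_Collect_eq)
  then obtain x' y' where *: "(step D)\<^sup>*\<^sup>* z x'" "step D x' y'" "P x'" "\<not> P y'"
    using rtranclp_leaveE[of "step D" z y P] assms by metis
  then have "x' \<in> component D z" "y' \<in> component D z"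
    by (auto simp: component_def)
  with * assms(1) that show ?thesis
    by (metis component_eq)
qed

text \<open>Along a path inside the component from a neighbour of \<open>v\<close> to a
  non-neighbour, adjacency to \<open>v\<close> is lost at some edge.\<close>

lemma mixed_edge:
  assumes "mixed (component D x) v"
  obtains y z where "y \<in> component D x" "z \<in> component D x" "E y z" "E v y" "\<not> E v z"
proof -
  obtain y z where "y \<in> component D x" "z \<in> component D x" "E v y" "\<not> E v z"
    using assms by (auto simp: mixed_def)
  from component_boundary_edge[of _ _ _ _ "E v", OF this] that show ?thesis
    unfolding step_def by metis
qed

lemma mixed_notin:
  assumes "mixed (component D x) v"
  shows "v \<notin> D"
  using assms unfolding mixed_def by (metis component_trace trace_eqD)

text \<open>With the same trace, a neighbour of \<open>v\<close> in the component would pull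
  \<open>v\<close> into it.\<close>

lemma mixed_trace:
  assumes "mixed (component D x) v" "x \<notin> D"
  shows "trace D v \<noteq> trace D x"
  using assms component_extend sym mixed_notin unfolding mixed_def by metis

text \<open>The edges given by \<open>mixed_edge\<close> in the two components, joined through
  \<open>v\<close>, form an induced path on five vertices.\<close>

lemma mixed_unique:
  assumes "x \<notin> D" "x' \<notin> D" "trace D x = trace D x'" "component D x \<noteq> component D x'"
    and "mixed (component D x) v" "mixed (component D x') v"
  shows False
proof -
  obtain y z where y: "y \<in> component D x" "z \<in> component D x" "E y z" "E v y" "\<not> E v z"
    using mixed_edge[OF assms(5)] by blast
  obtain y' z' where y': "y' \<in> component D x'" "z' \<in> component D x'" "E y' z'" "E v y'" "\<not> E v z'"
    using mixed_edge[OF assms(6)] by blast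
  have "\<not> E z v" "\<not> E z y'" "\<not> E z z'" "\<not> E y y'" "\<not> E y z'"
    using component_anticomplete assms(1-4) y y' sym by blast+
  then show False
    using P5[of z y v y' z'] y y' sym by blast
qed

text \<open>By \<open>mixed_unique\<close> each of \<open>v\<close>, \<open>v'\<close> sees both or
  none of the ends of the edge chosen for the other. If \<open>v\<close> and \<open>v'\<close> were
  non-adjacent, then two symmetric answers would give the configuration of \<open>crossing\<close>,
  and two different ones an induced path on five vertices directly.\<close>

lemma mixed_adjacent:
  assumes xx': "x \<notin> D" "x' \<notin> D" "trace D x = trace D x'" "component D x \<noteq> component D x'"
    and "mixed (component D x) v" "mixed (component D x') v'" "trace D v = trace D v'"
  shows "E v v'"
proof (rule ccontr)
  assume nadj: "\<not> E v v'"
  obtain y z where y: "y \<in> component D x" "z \<in> component D x" "E y z" "E v y" "\<not> E v z"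
    using mixed_edge[OF assms(5)] by blast
  obtain y' z' where y': "y' \<in> component D x'" "z' \<in> component D x'" "E y' z'" "E v' y'" "\<not> E v' z'"
    using mixed_edge[OF assms(6)] by blast
  have anti: "\<not> E s t" "\<not> E t s" if "s \<in> component D x" "t \<in> component D x'" for s t
    using component_anticomplete[OF that xx'] sym by blast+
  have "v \<notin> component D x'" "v' \<notin> component D x"
    using y y' anti by blast+
  moreover have "\<not> mixed (component D x') v" "\<not> mixed (component D x) v'"
    using mixed_unique[OF xx'] assms(5,6) by blast+
  ultimately have hom: "E v y' \<longleftrightarrow> E v z'" "E v' y \<longleftrightarrow> E v' z"
    using y y' unfolding mixed_def by blast+
  have tr: "trace D y = trace D x" "trace D z = trace D x" "trace D y' = trace D x" "trace D z' = trace D x"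
    using y y' component_trace xx'(3) by metis+
  have ne: "trace D x \<noteq> trace D v"
    using mixed_trace[OF assms(5)] xx' by metis
  show False
  proof (cases "E v y'"; cases "E v' y")
    assume "E v y'" "E v' y"
    then show False
      using crossing[of D z' z v v'] tr ne assms(7) hom y y' anti nadj sym by metis
  next
    assume "\<not> E v y'" "\<not> E v' y"
    then show False
      using crossing[of D y y' v v'] tr ne assms(7) hom y y' anti nadj sym by metis
  next
    assume "\<not> E v y'" "E v' y"
    then show False
      using P5[of v y v' y' z'] y y' anti nadj hom sym by blast
  next
    assume "E v y'" "\<not> E v' y"
    then show False
      using P5[of v' y' v y z] y y' anti nadj hom sym by blast
  qed
qed

subsection \<open>Cliques\<close>

definition clique :: "'a set \<Rightarrow> bool" where
  "clique Q \<longleftrightarrow> (\<forall>x\<in>Q. \<forall>y\<in>Q. x \<noteq> y \<longrightarrow> E x y)"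

text \<open>After the removal of one of its vertices, a clique lies in a \<open>q\<close>-colourable
  graph.\<close>

lemma clique_card:
  assumes "clique Q" "Q \<subseteq> V"
  shows "card Q \<le> q + 1"
proof (cases "Q = {}")
  case False
  then obtain x where x: "x \<in> Q"
    by blast
  then obtain c where c: "\<forall>v\<in>V - {x}. c v < q" "\<forall>u\<in>V - {x}. \<forall>v\<in>V - {x}. E u v \<longrightarrow> c u \<noteq> c v"
    using colourable_remove[of x] assms(2) unfolding colourable_def by blast
  have "inj_on c (Q - {x})"
    using assms c(2) unfolding clique_def inj_on_def by blast
  moreover have "c ` (Q - {x}) \<subseteq> {..<q}"
    using assms(2) c(1) by auto
  ultimately have "card (Q - {x}) \<le> card {..<q}"
    by (intro card_inj_on_le) auto
  then show ?thesis
    by (simp add: x card.insert_remove)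
qed simp

lemma no_large_clique:
  assumes "\<And>i j. i < j \<Longrightarrow> j < q + 2 \<Longrightarrow> E (f i) (f j)"
  shows False
proof -
  have adj: "E (f i) (f j)" if "i \<noteq> j" "i < q + 2" "j < q + 2" for i j :: nat
    using that assms[of i j] assms[of j i] sym by (cases "i < j") auto
  have "inj_on f {..<q + 2}"
    using adj irrefl by (auto simp: inj_on_def) metis
  then have "card (f ` {..<q + 2}) = q + 2"
    by (simp add: card_image)
  moreover have "clique (f ` {..<q + 2})"
    unfolding clique_def
  proof (intro ballI impI)
    fix x y
    assume "x \<in> f ` {..<q + 2}" "y \<in> f ` {..<q + 2}" "x \<noteq> y"
    then obtain i j where "i < q + 2" "j < q + 2" "x = f i" "y = f j" "i \<noteq> j"
      by auto
    then show "E x y"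
      by (simp add: adj)
  qed
  moreover have "f ` {..<q + 2} \<subseteq> V"
  proof
    fix y
    assume "y \<in> f ` {..<q + 2}"
    then obtain i where i: "i < q + 2" "y = f i"
      by auto
    \<comment> \<open>Any neighbour shows that \<open>f i\<close> is a vertex of the graph; the
      index 0 or 1 supplies one.\<close>
    have "E (f i) (f (if i = 0 then 1 else 0))"
      using i by (intro adj) auto
    then show "y \<in> V"
      using i edge_V by blast
  qed
  ultimately show False
    using clique_card by fastforce
qed


section \<open>Counting components; those with a mixed vertex\<close>

lemma card_components_le:
  assumes "finite D" "card D \<le> d" "finite I" "card I \<le> r"
    and sub: "\<And>K. K \<in> A \<Longrightarrow> \<exists>x\<in>V - D. K = component D x \<and> f K \<in> I"
    and bound: "\<And>S i. S \<subseteq> D \<Longrightarrow> i \<in> I \<Longrightarrow>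
      card {K \<in> A. (\<forall>y\<in>K. trace D y = S) \<and> f K = i} \<le> m"
  shows "card A \<le> 2 ^ d * r * m"
proof -
  \<comment> \<open>The components are sorted by their common trace, with at most
    \<open>2 ^ d\<close> possibilities, and by a label \<open>f K\<close> with at most
    \<open>r\<close> values; each cell has at most \<open>m\<close> members.\<close>
  let ?A = "\<lambda>(S, i). {K \<in> A. (\<forall>y\<in>K. trace D y = S) \<and> f K = i}"
  have finA: "finite A"
  proof (rule finite_subset)
    show "A \<subseteq> components D"
      using sub by (auto simp: components_def)
  qed (rule components_finite)
  have "A \<subseteq> (\<Union>p\<in>Pow D \<times> I. ?A p)"
  proof
    fix K
    assume "K \<in> A"
    then obtain x where x: "x \<in> V - D" "K = component D x" "f K \<in> I"
      using sub by blast
    then have "K \<in> ?A (trace D x, f K)"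
      using \<open>K \<in> A\<close> component_trace by simp
    moreover have "(trace D x, f K) \<in> Pow D \<times> I"
      using x by (auto simp: trace_def)
    ultimately show "K \<in> (\<Union>p\<in>Pow D \<times> I. ?A p)"
      by (rule UN_I[rotated])
  qed
  then have "card A \<le> card (\<Union>p\<in>Pow D \<times> I. ?A p)"
    using finA by (intro card_mono) (auto intro: finite_subset)
  also have "\<dots> \<le> (\<Sum>p\<in>Pow D \<times> I. card (?A p))"
    using assms by (intro card_UN_le) auto
  also have "\<dots> \<le> of_nat (card (Pow D \<times> I)) * m"
    using bound by (intro sum_bounded_above) auto
  also have "\<dots> = 2 ^ card D * card I * m"
    using assms by (simp add: card_cartesian_product card_Pow)
  also have "\<dots> \<le> 2 ^ d * r * m"
    using assms by (intro mult_le_mono) auto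
  finally show ?thesis .
qed

text \<open>Label each component with the trace of a chosen mixed vertex. Within one cell these
  chosen vertices are distinct and form a clique by \<open>mixed_adjacent\<close>.\<close>

lemma card_mixed_components:
  assumes "finite D" "card D \<le> d"
  shows "card {K \<in> components D. \<exists>v. mixed K v} \<le> 2 ^ d * 2 ^ d * (q + 1)"
proof -
  define w where "w K = (SOME v. mixed K v)" for K
  have w: "mixed K (w K)" if "\<exists>v. mixed K v" for K
    unfolding w_def using that by (rule someI_ex)
  show ?thesis
  proof (rule card_components_le[OF assms, where I = "Pow D" and f = "\<lambda>K. trace D (w K)"])
    show "card (Pow D) \<le> 2 ^ d"
      using assms by (simp add: card_Pow)
    fix S T
    let ?A = "{K \<in> {K \<in> components D. \<exists>v. mixed K v}. (\<forall>y\<in>K. trace D y = S) \<and> trace D (w K) = T}"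
    have adj: "E (w K) (w K')" if K: "K \<in> ?A" "K' \<in> ?A" "K \<noteq> K'" for K K'
    proof -
      obtain x x' where x: "x \<in> V - D" "K = component D x" "x' \<in> V - D" "K' = component D x'"
        using K by (auto simp: components_def)
      then have "trace D x = trace D x'"
        using K self_in_component by auto
      then show ?thesis
        using x K w by (intro mixed_adjacent[of x D x']) auto
    qed
    have inj: "inj_on w ?A"
    proof (rule inj_onI, rule ccontr)
      fix K K'
      assume "K \<in> ?A" "K' \<in> ?A" "w K = w K'" "K \<noteq> K'"
      then show False
        using adj[of K K'] irrefl by simp
    qed
    have "w K \<in> V" if "K \<in> ?A" for K
      using that w[of K] edge_V by (auto simp: mixed_def)
    moreover have "clique (w ` ?A)"
      using adj by (auto simp: clique_def)
    ultimately have "card (w ` ?A) \<le> q + 1"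
      by (intro clique_card) auto
    then show "card ?A \<le> q + 1"
      using card_image[OF inj] by simp
  qed (use assms in \<open>auto simp: components_def trace_def\<close>)
qed

subsection \<open>Components without mixed vertices\<close>

definition chi :: "'a set \<Rightarrow> nat" where
  "chi A = (LEAST n. colourable E A n)"

text \<open>Renumbering the colours that actually occur makes \<open>chi\<close> a lower bound for
  the number of colours which a given colouring uses on a set.\<close>

lemma colourable_image:
  assumes "finite A" "\<forall>u\<in>A. \<forall>v\<in>A. E u v \<longrightarrow> c u \<noteq> c v"
  shows "colourable E A (card (c ` A))"
proof -
  obtain e where e: "bij_betw e (c ` A) {0..<card (c ` A)}"
    using ex_bij_betw_finite_nat[of "c ` A"] assms(1) by blast
  show ?thesis
    unfolding colourable_def
  proof (intro exI conjI ballI impI)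
    fix v
    assume v: "v \<in> A"
    then show "(e \<circ> c) v < card (c ` A)"
      using bij_betwE[OF e] by simp
    fix u
    assume "u \<in> A" "E v u"
    then show "(e \<circ> c) v \<noteq> (e \<circ> c) u"
      using v assms(2) bij_betw_imp_inj_on[OF e] by (auto dest!: inj_onD)
  qed
qed

lemma colourable_chi: "finite A \<Longrightarrow> colourable E A (chi A)"
  unfolding chi_def
  by (rule LeastI[of _ "card (id ` A)"], rule colourable_image) (auto simp: irrefl)

lemma chi_le: "colourable E A n \<Longrightarrow> chi A \<le> n"
  unfolding chi_def by (rule Least_le)

text \<open>One extra colour \<open>q\<close> is given to a vertex \<open>x\<close> whose removal
  leaves a \<open>q\<close>-colourable graph.\<close>

lemma chi_subset_V:
  assumes "A \<subseteq> V"
  shows "chi A \<le> q + 1"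
proof (cases "A = {}")
  case True
  then show ?thesis
    by (intro chi_le) (auto simp: colourable_def)
next
  case False
  then obtain x where x: "x \<in> V"
    using assms by blast
  then obtain c where c: "\<forall>v\<in>V - {x}. c v < q" "\<forall>u\<in>V - {x}. \<forall>v\<in>V - {x}. E u v \<longrightarrow> c u \<noteq> c v"
    using colourable_remove[of x] unfolding colourable_def by blast
  have "colourable E A (q + 1)"
    unfolding colourable_def
  proof (intro exI conjI ballI impI)
    fix v
    assume v: "v \<in> A"
    then show "(c(x := q)) v < q + 1"
      using c(1) assms by (auto simp: less_Suc_eq)
    fix u
    assume u: "u \<in> A" "E v u"
    then have "u \<in> V" "v \<in> V" "u \<noteq> v"
      using u v assms irrefl by auto
    then have "u \<noteq> x \<Longrightarrow> c u < q" "v \<noteq> x \<Longrightarrow> c v < q" "u \<noteq> x \<Longrightarrow> v \<noteq> x \<Longrightarrow> c v \<noteq> c u"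
      using c u by simp_all
    then show "(c(x := q)) v \<noteq> (c(x := q)) u"
      using \<open>u \<noteq> v\<close> by auto
  qed
  then show ?thesis
    by (rule chi_le)
qed

text \<open>Otherwise a colouring of the rest of the graph could be extended to the component of
  \<open>a\<close>, reusing the colours of the component of \<open>a'\<close>.\<close>

lemma unmixed_components_incomparable:
  assumes a: "a \<in> V - D" "a' \<in> V - D" "trace D a = trace D a'" "component D a \<noteq> component D a'"
    and unmixed: "\<And>v. \<not> mixed (component D a) v" "\<And>v. \<not> mixed (component D a') v"
    and chi: "chi (component D a) \<le> chi (component D a')"
  shows "\<exists>v. v \<notin> D \<and> E v a \<and> \<not> E v a' \<and> trace D v \<noteq> trace D a"
proof (rule ccontr)
  assume *: "\<not> ?thesis"
  let ?K = "component D a" and ?K' = "component D a'"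
  have subV: "?K \<subseteq> V" "?K' \<subseteq> V"
    using a component_V by auto
  have anti: "\<not> E y y'" if "y \<in> ?K" "y' \<in> ?K'" for y y'
    using component_anticomplete[OF that] a by simp
  have disj: "y \<notin> ?K'" if "y \<in> ?K" for y
    using that component_eq a(4) by blast
  obtain c where c: "\<forall>v\<in>V - {a}. c v < q" "\<forall>u\<in>V - {a}. \<forall>v\<in>V - {a}. E u v \<longrightarrow> c u \<noteq> c v"
    using colourable_remove[of a] a unfolding colourable_def by blast
  have K'a: "?K' \<subseteq> V - {a}"
    using subV disj self_in_component by blast
  have fin: "finite ?K" "finite ?K'"
    using a component_finite by auto
  have "\<forall>u\<in>?K'. \<forall>v\<in>?K'. E u v \<longrightarrow> c u \<noteq> c v"
    using c(2) K'a by blast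
  then have "chi ?K' \<le> card (c ` ?K')"
    using fin by (intro chi_le colourable_image)
  then have "card {..<chi ?K} \<le> card (c ` ?K')"
    using chi by simp
  \<comment> \<open>Enough colours of \<open>c\<close> occur on \<open>?K'\<close> to recolour all
    of \<open>?K\<close> with them.\<close>
  then obtain e where e: "inj_on e {..<chi ?K}" "e ` {..<chi ?K} \<subseteq> c ` ?K'"
    using card_le_inj[of "{..<chi ?K}" "c ` ?K'"] fin by auto
  obtain g where g: "\<forall>v\<in>?K. g v < chi ?K" "\<forall>u\<in>?K. \<forall>v\<in>?K. E u v \<longrightarrow> g u \<noteq> g v"
    using colourable_chi[OF fin(1)] unfolding colourable_def by blast
  \<comment> \<open>An outside neighbour \<open>v\<close> of \<open>?K\<close> is complete to
    \<open>?K\<close>, hence adjacent to \<open>a\<close>. It is then adjacent to \<open>a'\<close>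
    as well, so it is complete to \<open>?K'\<close> and its colour does not occur there.\<close>
  have outer: "e (g u) \<noteq> c v" if u: "u \<in> ?K" and v: "v \<in> V - ?K" and "E u v" for u v
  proof -
    have "E v a"
      using unmixed(1)[of v] u v \<open>E u v\<close> self_in_component[of a D] sym
      unfolding mixed_def by blast
    have "E v a'"
    proof (cases "v \<in> D")
      case True
      then show ?thesis
        using trace_eqD[OF a(3)] \<open>E v a\<close> by blast
    next
      case False
      moreover have "trace D v \<noteq> trace D a"
        using component_extend[OF self_in_component _ sym[OF \<open>E v a\<close>] False] a v by auto
      ultimately show ?thesis
        using * \<open>E v a\<close> by blast
    qed
    moreover have "v \<notin> ?K'"
      using anti u \<open>E u v\<close> by blast
    ultimately have complete: "E v w" if "w \<in> ?K'" for w
      using unmixed(2)[of v] that self_in_component[of a' D] unfolding mixed_def by blast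
    obtain w where w: "w \<in> ?K'" "e (g u) = c w"
      using e(2) g(1) u by (metis (no_types, lifting) image_iff image_subset_iff lessThan_iff)
    have "v \<in> V - {a}" "w \<in> V - {a}"
      using v w K'a self_in_component[of a D] by auto
    then show ?thesis
      using c(2) complete[OF w(1)] w(2) by metis
  qed
  have "colourable E V q"
    unfolding colourable_def
  proof (intro exI conjI ballI impI)
    let ?c = "\<lambda>v. if v \<in> ?K then e (g v) else c v"
    fix v
    assume v: "v \<in> V"
    show "?c v < q"
    proof (cases "v \<in> ?K")
      case True
      then have "e (g v) \<in> c ` ?K'"
        using e(2) g(1) by auto
      then show ?thesis
        using True c(1) K'a by auto
    next
      case False
      then show ?thesis
        using c(1) v self_in_component[of a D] by auto
    qed
    fix u
    assume u: "u \<in> V" "E v u"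
    have "e (g v) \<noteq> e (g u)" if "v \<in> ?K" "u \<in> ?K"
      using that g u inj_onD[OF e(1)] by (metis lessThan_iff)
    moreover have "c v \<noteq> c u" if "v \<notin> ?K" "u \<notin> ?K"
      using that c(2) u v self_in_component[of a D] by blast
    ultimately show "?c v \<noteq> ?c u"
      using outer[of v u] outer[of u v] u v sym by auto
  qed
  then show False
    using not_colourable by blast
qed


text \<open>If \<open>p i j\<close> and \<open>p k l\<close> were always adjacent for disjoint (or for nested) pairs of indices, a large clique
  would arise; every other pattern except that of a half graph contains the configuration of
  \<open>crossing\<close>.\<close>

lemma uniform_pattern:
  assumes m: "m \<ge> 2 * q + 4"
    and a: "\<And>i. i < m \<Longrightarrow> trace D (a i) = S"
      "\<And>i j. i < m \<Longrightarrow> j < m \<Longrightarrow> \<not> E (a i) (a j)"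
    and p: "\<And>i j. i < j \<Longrightarrow> j < m \<Longrightarrow> E (p i j) (a i)"
      "\<And>i j. i < j \<Longrightarrow> j < m \<Longrightarrow> \<not> E (p i j) (a j)"
      "\<And>i j. i < j \<Longrightarrow> j < m \<Longrightarrow> trace D (p i j) = T"
    and "T \<noteq> S"
    and below: "\<And>i j k. i < j \<Longrightarrow> j < k \<Longrightarrow> k < m \<Longrightarrow> E (p j k) (a i) \<longleftrightarrow> lo"
    and above: "\<And>i j k. i < j \<Longrightarrow> j < k \<Longrightarrow> k < m \<Longrightarrow> E (p i j) (a k) \<longleftrightarrow> hi"
    and disjoint: "\<And>i j k l. i < j \<Longrightarrow> j < k \<Longrightarrow> k < l \<Longrightarrow> l < m \<Longrightarrow> E (p i j) (p k l) \<longleftrightarrow> ds"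
    and nested: "\<And>i j k l. i < j \<Longrightarrow> j < k \<Longrightarrow> k < l \<Longrightarrow> l < m \<Longrightarrow> E (p i l) (p j k) \<longleftrightarrow> ns"
  shows lo "\<not> hi" "\<not> ds"
proof -
  show "\<not> ds"
  proof
    assume ds
    \<comment> \<open>The \<open>q + 2\<close> disjoint pairs of consecutive indices fit below
      \<open>m\<close>; for \<open>ns\<close> below, the \<open>q + 2\<close> nested pairs summing
      to \<open>2 * q + 3\<close> do the same.\<close>
    then show False
      using m by (intro no_large_clique[of "\<lambda>t. p (2 * t) (2 * t + 1)"]) (simp add: disjoint)
  qed
  have "\<not> ns"
  proof
    assume ns
    then show False
      using m by (intro no_large_clique[of "\<lambda>t. p t (2 * q + 3 - t)"]) (simp add: nested)
  qed
  have m4: "0 < m" "1 < m" "2 < m" "3 < m"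
    using m by auto
  have nadj: "\<not> E (p 0 1) (p 2 3)" "\<not> E (p 0 3) (p 1 2)"
    using disjoint[of 0 1 2 3] nested[of 0 1 2 3] \<open>\<not> ds\<close> \<open>\<not> ns\<close> m4 by auto
  have tr: "trace D (a 0) = trace D (a 2)" "trace D (a 3) = trace D (a 1)"
    "trace D (a 0) = trace D (a 3)" "trace D (p 0 1) = trace D (p 2 3)"
    "trace D (p 0 3) = trace D (p 1 2)" "trace D (a 0) \<noteq> trace D (p 0 1)"
    "trace D (a 3) \<noteq> trace D (p 0 1)" "trace D (a 0) \<noteq> trace D (p 0 3)"
    using a(1) p(3) \<open>T \<noteq> S\<close> m4 by simp_all
  have own: "E (a 0) (p 0 1)" "E (a 2) (p 2 3)" "E (a 0) (p 0 3)" "\<not> E (a 1) (p 0 1)"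
    "\<not> E (a 3) (p 2 3)" "\<not> E (a 3) (p 0 3)"
    using p(1,2) m4 sym_iff by simp_all
  have other: "E (a 2) (p 0 1) \<longleftrightarrow> hi" "E (a 0) (p 2 3) \<longleftrightarrow> lo" "E (a 3) (p 0 1) \<longleftrightarrow> hi"
    "E (a 1) (p 2 3) \<longleftrightarrow> lo" "E (a 3) (p 1 2) \<longleftrightarrow> hi" "E (a 0) (p 1 2) \<longleftrightarrow> lo"
    using above below m4 sym_iff by simp_all
  \<comment> \<open>Three uses of \<open>crossing\<close> exclude in turn neither of
    \<open>lo\<close> and \<open>hi\<close>, both of them, and \<open>hi\<close> alone. The last one
    compares nested pairs, the others disjoint ones.\<close>
  have "lo \<or> hi"
    using crossing[OF tr(1,4,6)] own other nadj a(2) m4 by blast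
  moreover have "\<not> (lo \<and> hi)"
    using crossing[OF tr(2,4,7)] own other nadj a(2) m4 by blast
  moreover have "lo \<or> \<not> hi"
    using crossing[OF tr(3,5,8)] own other nadj a(2) m4 by blast
  ultimately show lo "\<not> hi"
    by blast+
qed

text \<open>The vertex \<open>p i j\<close> witnesses that the neighbourhood of \<open>a i\<close>
  is not contained in that of \<open>a j\<close>. After Ramsey's theorem the witnesses with
  \<open>i < j\<close> and those with \<open>i > j\<close> form half graphs of opposite directions,
  and every possible adjacency between the two kinds of witnesses gives a forbidden
  subgraph.\<close>

lemma no_large_antichain:
  assumes D: "finite D" "card D \<le> d"
    and N: "quad_ramsey (2 ^ d * (2 ^ d * 2 ^ 10)) (2 * q + 16) \<le> N"
    and a: "\<And>i. i < N \<Longrightarrow> trace D (a i) = S"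
      "\<And>i j. i < N \<Longrightarrow> j < N \<Longrightarrow> \<not> E (a i) (a j)"
    and p: "\<And>i j. i < N \<Longrightarrow> j < N \<Longrightarrow> i \<noteq> j \<Longrightarrow> E (p i j) (a i)"
      "\<And>i j. i < N \<Longrightarrow> j < N \<Longrightarrow> i \<noteq> j \<Longrightarrow> \<not> E (p i j) (a j)"
      "\<And>i j. i < N \<Longrightarrow> j < N \<Longrightarrow> i \<noteq> j \<Longrightarrow> trace D (p i j) \<noteq> S"
  shows False
proof -
  define n where "n = 2 * q + 16"
  \<comment> \<open>Colours are read off quadruples. Reserving the two largest indices
    \<open>m\<close> and \<open>n - 1\<close> allows pairs and triples below \<open>m\<close> to be
    completed to increasing quadruples.\<close>
  define m where "m = n - 2"
  \<comment> \<open>The colour records the traces of both witnesses of a pair and ten adjacencies: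
    those with a third index, and those between witnesses of disjoint or nested pairs in the
    orientations used below.\<close>
  define col where "col i j k l = (trace D (p i j), trace D (p j i),
    [E (p j k) (a i), E (p i j) (a k), E (p i j) (p k l), E (p i l) (p j k),
     E (p k j) (a i), E (p j i) (a k), E (p j i) (p l k), E (p l i) (p k j),
     E (p i j) (p l k), E (p j i) (p k l)])" for i j k l
  let ?C = "Pow D \<times> Pow D \<times> {xs :: bool list. set xs \<subseteq> UNIV \<and> length xs = 10}"
  have C: "finite ?C"
    using D(1) by (intro finite_cartesian_product finite_lists_length_eq) auto
  have "card ?C = 2 ^ card D * (2 ^ card D * 2 ^ 10)"
    using D(1) card_lists_length_eq[of "UNIV :: bool set" 10]
    by (simp add: card_cartesian_product card_Pow)
  also have "\<dots> \<le> 2 ^ d * (2 ^ d * 2 ^ 10)"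
    using D(2) by (intro mult_le_mono) auto
  finally have card_C: "card ?C \<le> 2 ^ d * (2 ^ d * 2 ^ 10)" .
  have col_C: "col i j k l \<in> ?C" for i j k l
    by (auto simp: col_def trace_def)
  obtain h x where h: "strict_mono_on {..<n} h" "\<And>i. i < n \<Longrightarrow> h i < N"
    and col: "\<And>i j k l. i < j \<Longrightarrow> j < k \<Longrightarrow> k < l \<Longrightarrow> l < n \<Longrightarrow> col (h i) (h j) (h k) (h l) = x"
    by (rule quad_ramseyE[OF C card_C N[folded n_def], where f = col, OF col_C]) (rule that; assumption)
  define b where "b i = a (h i)" for i
  define r where "r i j = p (h i) (h j)" for i j
  obtain T T' c1 c2 c3 c4 c5 c6 c7 c8 c9 c10
    where x: "x = (T, T', [c1, c2, c3, c4, c5, c6, c7, c8, c9, c10])"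
    using col[of 0 1 2 3] unfolding col_def n_def by fastforce
  have uni: "trace D (r i j) = T" "trace D (r j i) = T'"
    "E (r j k) (b i) = c1" "E (r i j) (b k) = c2" "E (r i j) (r k l) = c3" "E (r i l) (r j k) = c4"
    "E (r k j) (b i) = c5" "E (r j i) (b k) = c6" "E (r j i) (r l k) = c7" "E (r l i) (r k j) = c8"
    "E (r i j) (r l k) = c9" "E (r j i) (r k l) = c10"
    if "i < j" "j < k" "k < l" "l < n" for i j k l
    using col[OF that] unfolding col_def x b_def r_def by auto
  have mn: "k < m \<Longrightarrow> k < n - 1" "k < m \<Longrightarrow> k < n" "m < n - 1" "n - 1 < n" "12 < m" "2 * q + 4 \<le> m" for k
    by (auto simp: m_def n_def)
  have b: "i < m \<Longrightarrow> trace D (b i) = S" "i < m \<Longrightarrow> j < m \<Longrightarrow> \<not> E (b i) (b j)" for i j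
    using a h(2) mn(2) by (auto simp: b_def)
  have r: "E (r i j) (b i)" "\<not> E (r i j) (b j)" "trace D (r i j) \<noteq> S" if "i \<noteq> j" "i < m" "j < m" for i j
  proof -
    have "h i \<noteq> h j"
      using that mn(2) strict_mono_on_imp_inj_on[OF h(1)] by (auto dest: inj_onD)
    then show "E (r i j) (b i)" "\<not> E (r i j) (b j)" "trace D (r i j) \<noteq> S"
      using that mn(2) h(2) p by (auto simp: b_def r_def)
  qed
  have trT: "trace D (r i j) = T" "trace D (r j i) = T'" if "i < j" "j < m" for i j
    using uni(1,2)[of i j m "n - 1"] that mn by blast+
  have uni3: "E (r j k) (b i) = c1" "E (r i j) (b k) = c2" "E (r k j) (b i) = c5" "E (r j i) (b k) = c6"
    if "i < j" "j < k" "k < m" for i j k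
    using uni(3,4,7,8)[of i j k "n - 1"] that mn by blast+
  have uni4: "E (r i j) (r k l) = c3" "E (r i l) (r j k) = c4"
    "E (r j i) (r l k) = c7" "E (r l i) (r k j) = c8" "E (r i j) (r l k) = c9" "E (r j i) (r k l) = c10"
    if "i < j" "j < k" "k < l" "l < m" for i j k l
    using uni(5,6,9-12)[of i j k l] that mn by blast+
  have neS: "T \<noteq> S" "T' \<noteq> S"
    using trT[of 0 1] r(3)[of 0 1] r(3)[of 1 0] mn(5) by auto
  have c123: "c1" "\<not> c2" "\<not> c3"
    using uniform_pattern[OF mn(6), of D b S r T c1 c2 c3 c4] b r trT uni3 uni4 neS by auto
  have c567: "c6" "\<not> c5" "\<not> c7"
  proof - \<comment> \<open>the pattern of \<open>r j i\<close> with \<open>i < j\<close> becomes that of \<open>r i j\<close> when the order is reversed\<close>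
    define f where "f i = m - 1 - i" for i
    have f: "f j < f i" "f i < m" if "i < j" "j < m" for i j
      using that by (auto simp: f_def)
    have f': "f i < m" if "i < m" for i
      using that by (auto simp: f_def)
    have 1: "i < j \<Longrightarrow> j < m \<Longrightarrow> E (r (f i) (f j)) (b (f i))" for i j
      using r(1)[of "f i" "f j"] f[of i j] f'[of j] by auto
    have 2: "i < j \<Longrightarrow> j < m \<Longrightarrow> \<not> E (r (f i) (f j)) (b (f j))" for i j
      using r(2)[of "f i" "f j"] f[of i j] f'[of j] by auto
    have 3: "i < j \<Longrightarrow> j < m \<Longrightarrow> trace D (r (f i) (f j)) = T'" for i j
      using trT(2)[of "f j" "f i"] f[of i j] by auto
    have 4: "i < j \<Longrightarrow> j < k \<Longrightarrow> k < m \<Longrightarrow> E (r (f j) (f k)) (b (f i)) = c6" for i j k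
      using uni3(4)[of "f k" "f j" "f i"] f[of i j] f[of j k] by auto
    have 5: "i < j \<Longrightarrow> j < k \<Longrightarrow> k < m \<Longrightarrow> E (r (f i) (f j)) (b (f k)) = c5" for i j k
      using uni3(3)[of "f k" "f j" "f i"] f[of i j] f[of j k] by auto
    have 6: "i < j \<Longrightarrow> j < k \<Longrightarrow> k < l \<Longrightarrow> l < m \<Longrightarrow> E (r (f i) (f j)) (r (f k) (f l)) = c7" for i j k l
      using uni4(3)[of "f l" "f k" "f j" "f i"] f[of i j] f[of j k] f[of k l]
      by (auto simp: sym_iff[of "r (f i) (f j)"])
    have 7: "i < j \<Longrightarrow> j < k \<Longrightarrow> k < l \<Longrightarrow> l < m \<Longrightarrow> E (r (f i) (f l)) (r (f j) (f k)) = c8" for i j k l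
      using uni4(4)[of "f l" "f k" "f j" "f i"] f[of i j] f[of j k] f[of k l] by auto
    note * = uniform_pattern[OF mn(6), of D "\<lambda>i. b (f i)" S "\<lambda>i j. r (f i) (f j)" T',
        OF b(1)[OF f'] b(2)[OF f' f'] 1 2 3 neS(2) 4 5 6 7, simplified]
    show "c6" "\<not> c5" "\<not> c7"
      using * by blast+
  qed
  \<comment> \<open>The \<open>y t\<close> and the \<open>z t\<close> form half graphs with the \<open>b i\<close> in opposite directions.\<close>
  define y where "y t = r (2 * t) (2 * t + 1)" for t
  define z where "z t = r (2 * t + 1) (2 * t)" for t
  have ya: "E (y t) (b i) \<longleftrightarrow> i \<le> 2 * t" if "t \<le> 5" "i \<le> 11" for t i
  proof -
    consider "i < 2 * t" | "i = 2 * t" | "i = 2 * t + 1" | "i > 2 * t + 1"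
      by linarith
    then show ?thesis
      using that mn(5) uni3(1)[of i "2 * t" "2 * t + 1"] uni3(2)[of "2 * t" "2 * t + 1" i]
        r(1,2)[of "2 * t" "2 * t + 1"] c123 unfolding y_def by cases auto
  qed
  have za: "E (z t) (b i) \<longleftrightarrow> i > 2 * t" if "t \<le> 5" "i \<le> 11" for t i
  proof -
    consider "i < 2 * t" | "i = 2 * t" | "i = 2 * t + 1" | "i > 2 * t + 1"
      by linarith
    then show ?thesis
      using that mn(5) uni3(3)[of i "2 * t" "2 * t + 1"] uni3(4)[of "2 * t" "2 * t + 1" i]
        r(1,2)[of "2 * t + 1" "2 * t"] c567 unfolding z_def by cases auto
  qed
  have yy: "\<not> E (y s) (y t)" "\<not> E (z s) (z t)" "E (y s) (z t) = c9" "E (z s) (y t) = c10"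
    if "s < t" "t \<le> 5" for s t
    using uni4(1,3,5,6)[of "2 * s" "2 * s + 1" "2 * t" "2 * t + 1"] that mn(5) c123 c567
    by (auto simp: y_def z_def)
  have yy': "\<not> E (y t) (y s)" "\<not> E (z t) (z s)" "E (z t) (y s) = c9" "E (y t) (z s) = c10"
    if "s < t" "t \<le> 5" for s t
    using yy[OF that] sym by blast+
  have ya': "E (b i) (y t) \<longleftrightarrow> i \<le> 2 * t" and za': "E (b i) (z t) \<longleftrightarrow> i > 2 * t"
    if "t \<le> 5" "i \<le> 11" for t i
    using ya[OF that] za[OF that] sym by blast+
  note adj = ya za ya' za' yy yy'
  show False
  proof (cases c10)
    \<comment> \<open>The 4-cycle \<open>z 1\<close>, \<open>y 4\<close>, \<open>z 2\<close>,
      \<open>y 5\<close> has the hub \<open>b 6\<close>, which lies in the range of all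
      four.\<close>
    case True
    have "y 4 \<noteq> y 5" "z 1 \<noteq> z 2"
      using ya[of 4 10] ya[of 5 10] za[of 1 3] za[of 2 3] by auto
    then show False
      using True W4[of "z 1" "y 4" "z 2" "y 5" "b 6"] by (simp add: adj)
  next
    case False
    show False
    proof (cases c9)
      \<comment> \<open>Now \<open>y s\<close> and \<open>z t\<close> with \<open>s < t\<close> are
        adjacent, but \<open>z s\<close> and \<open>y t\<close> are not. This asymmetry yields an
        induced path.\<close>
      case True
      then show False
        using \<open>\<not> c10\<close> P5[of "y 1" "z 3" "y 2" "b 4" "y 4"] by (simp add: adj)
    next
      \<comment> \<open>With no such edges between the \<open>y t\<close> and the
        \<open>z t\<close>, the path alternates between witnesses and the vertices
        \<open>b i\<close>.\<close>
      case False
      then show False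
        using \<open>\<not> c10\<close> P5[of "y 2" "b 4" "z 1" "b 7" "z 3"] b(2)[of 4 7] mn(5) by (simp add: adj)
    qed
  qed
qed

end

section \<open>Bounds for components, dominating sets and refinements\<close>

definition component_bound :: "nat \<Rightarrow> nat \<Rightarrow> nat" where
  "component_bound q d = 2 ^ d * 2 ^ d * (q + 1) +
     2 ^ d * (q + 2) * quad_ramsey (2 ^ d * (2 ^ d * 2 ^ 10)) (2 * q + 16)"

text \<open>The summands bound the start vertex \<open>v\<close>, the set \<open>U\<close> and the
  set \<open>W'\<close> in the proof of \<open>component_dominated\<close>. The arguments
  \<open>d + 1\<close> and \<open>d + 2\<close> arise because \<open>D\<close> is enlarged by one
  and by two vertices.\<close>

definition domination_bound :: "nat \<Rightarrow> nat \<Rightarrow> nat" where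
  "domination_bound q d =
     1 + component_bound q (d + 1) + component_bound q (d + 1) * component_bound q (d + 2)"

definition refined_size :: "nat \<Rightarrow> nat \<Rightarrow> nat" where
  "refined_size q d = d + component_bound q d * domination_bound q d"

context critical_P5_W4_free begin

text \<open>The label is now \<open>chi\<close>, with \<open>q + 2\<close> possible values. In one
  cell all chromatic numbers agree, so \<open>unmixed_components_incomparable\<close> applies in
  both directions and its witnesses contradict \<open>no_large_antichain\<close> once the cell is
  too large.\<close>

lemma card_unmixed_components:
  assumes D: "finite D" "card D \<le> d"
  shows "card {K \<in> components D. \<forall>v. \<not> mixed K v}
    \<le> 2 ^ d * (q + 2) * quad_ramsey (2 ^ d * (2 ^ d * 2 ^ 10)) (2 * q + 16)"
    (is "card ?U \<le> _ * ?R")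
proof (rule card_components_le[OF D, where I = "{..q + 1}" and f = chi])
  fix K
  assume "K \<in> ?U"
  then obtain x where x: "x \<in> V - D" "K = component D x"
    unfolding components_def by blast
  then have "K \<subseteq> V"
    using component_V by blast
  with x show "\<exists>x\<in>V - D. K = component D x \<and> chi K \<in> {..q + 1}"
    using chi_subset_V by blast
next
  fix S i
  let ?A = "{K \<in> ?U. (\<forall>y\<in>K. trace D y = S) \<and> chi K = i}"
  show "card ?A \<le> ?R"
  proof (rule ccontr)
    assume large: "\<not> card ?A \<le> ?R"
    define N where "N = card ?A"
    have "finite ?A"
      using components_finite by simp
    then obtain e where e: "bij_betw e {0..<N} ?A"
      unfolding N_def using ex_bij_betw_nat_finite by blast
    have "\<forall>K\<in>?A. \<exists>x. x \<in> V - D \<and> K = component D x"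
      by (auto simp: components_def)
    from bchoice[OF this] obtain rep where rep: "\<forall>K\<in>?A. rep K \<in> V - D \<and> K = component D (rep K)"
      by blast
    define a where "a j = rep (e j)" for j
    have eA: "e j \<in> ?A" if "j < N" for j
      using bij_betwE[OF e] that by simp
    have a: "a j \<in> V - D" "e j = component D (a j)" if "j < N" for j
      using bspec[OF rep eA[OF that]] by (auto simp: a_def)
    have tr: "trace D (a j) = S" if "j < N" for j
      using eA[OF that] a(2)[OF that] self_in_component by auto
    have ne: "component D (a j) \<noteq> component D (a k)" if "j < N" "k < N" "j \<noteq> k" for j k
      using that bij_betw_imp_inj_on[OF e] a(2) by (metis atLeastLessThan_iff inj_onD le0)
    have "\<exists>v. v \<notin> D \<and> E v (a j) \<and> \<not> E v (a k) \<and> trace D v \<noteq> trace D (a j)"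
      if "j < N" "k < N" "j \<noteq> k" for j k
      using that a[of j] a[of k] tr[of j] tr[of k] ne[of j k] eA[of j] eA[of k]
      by (intro unmixed_components_incomparable) auto
    then have "\<exists>v. E v (a j) \<and> \<not> E v (a k) \<and> trace D v \<noteq> S"
      if "j < N" "k < N" "j \<noteq> k" for j k
      using that tr by metis
    then obtain p where p: "\<And>j k. j < N \<Longrightarrow> k < N \<Longrightarrow> j \<noteq> k \<Longrightarrow>
        E (p j k) (a j) \<and> \<not> E (p j k) (a k) \<and> trace D (p j k) \<noteq> S"
      by metis
    have nadj: "\<not> E (a j) (a k)" if "j < N" "k < N" for j k
    proof (cases "j = k")
      case False
      then show ?thesis
        using component_anticomplete[OF self_in_component self_in_component, of "a j" D "a k"]
          that a tr ne by auto
    qed (simp add: irrefl)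
    show False
      using no_large_antichain[OF D, of N a S p] large tr nadj p by (auto simp: N_def)
  qed
qed (use D in auto)

lemma card_components:
  assumes "finite D" "card D \<le> d"
  shows "card (components D) \<le> component_bound q d"
proof -
  have "components D = {K \<in> components D. \<exists>v. mixed K v} \<union> {K \<in> components D. \<forall>v. \<not> mixed K v}"
    by blast
  then have "card (components D) \<le>
      card {K \<in> components D. \<exists>v. mixed K v} + card {K \<in> components D. \<forall>v. \<not> mixed K v}"
    using card_Un_le by metis
  then show ?thesis
    unfolding component_bound_def
    using card_mixed_components[OF assms] card_unmixed_components[OF assms] by linarith
qed

subsection \<open>Dominating the components\<close>

lemma component_insert_subset: "component (insert v D) x \<subseteq> component D x"
proof -
  have "step (insert v D) \<le> step D"
    unfolding step_def trace_def by blast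
  then show ?thesis
    unfolding component_def using rtranclp_mono by blast
qed

lemma component_insert_nonadjacent:
  assumes "y \<in> component (insert v D) x" "\<not> E v x"
  shows "\<not> E v y"
  using component_trace[OF assms(1)] assms(2) unfolding trace_def by blast

text \<open>An edge \<open>zu\<close> leaving the smaller component inside the larger one changes
  only the adjacency to \<open>v\<close>, and \<open>z\<close> is not adjacent to
  \<open>v\<close>.\<close>

lemma component_insert_exit:
  assumes x: "x \<notin> insert v D" "\<not> E v x"
    and y: "y \<in> component D x" "y \<notin> component (insert v D) x"
  obtains z u where "z \<in> component (insert v D) x" "u \<in> component D x" "E z u" "u = v \<or> E v u"
proof -
  obtain z u where z: "u \<in> component D x" "step D z u"
      "z \<in> component (insert v D) x" "u \<notin> component (insert v D) x"
    using component_boundary_edge[OF self_in_component y(1),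
        where P = "\<lambda>y. y \<in> component (insert v D) x"] y(2) self_in_component by metis
  have "u = v \<or> E v u"
  proof (rule ccontr)
    assume *: "\<not> ?thesis"
    have "\<not> E v z"
      using component_insert_nonadjacent[OF z(3) x(2)] .
    then have "trace (insert v D) u = trace (insert v D) z"
      using z(2) * by (auto simp: step_def trace_def)
    then have "trace (insert v D) u = trace (insert v D) x"
      using component_trace[OF z(3)] by simp
    then show False
      using component_extend[OF z(3) x(1)] z * by (auto simp: step_def)
  qed
  with z that show ?thesis
    by (auto simp: step_def)
qed

text \<open>The induced path argument of Gyarfas, cut off after two rounds. If \<open>x\<close> is
  not dominated by \<open>v\<close>, a neighbour \<open>t\<close> of \<open>v\<close> with a
  neighbour in the component \<open>C\<close> of \<open>x\<close> after inserting \<open>v\<close>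
  is tried. If \<open>t\<close> fails too, some \<open>w\<close> in \<open>C\<close> adjacent to
  \<open>t\<close> is complete to the component of \<open>x\<close> after inserting \<open>t\<close>
  as well. One vertex of each kind per component suffices.\<close>

lemma component_dominated:
  assumes v: "v \<in> V - D" and D: "finite D" "card D \<le> d"
  obtains W where "W \<subseteq> component D v" "finite W" "card W \<le> domination_bound q d"
    "\<And>x. x \<in> component D v \<Longrightarrow> x \<in> W \<or> (\<exists>w\<in>W. E w x)"
proof -
  let ?K = "component D v" and ?D = "insert v D"
  define U_of where "U_of C u \<longleftrightarrow> u \<in> ?K \<and> E v u \<and> (\<exists>y\<in>C. E u y)" for C u
  define \<C> where "\<C> = {C \<in> components ?D. \<exists>u. U_of C u}"
  define U where "U = (\<lambda>C. SOME u. U_of C u) ` \<C>"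
  \<comment> \<open>Only completeness to \<open>C\<close> is required, so that any chosen vertex
    dominates \<open>C\<close>, not just the one constructed from the path.\<close>
  define W_of where "W_of C w \<longleftrightarrow> w \<in> ?K \<and> (\<forall>y\<in>C. E w y)" for C w
  define \<C>' where "\<C>' u = {C \<in> components (insert u ?D). \<exists>w. W_of C w}" for u
  define W' where "W' = (\<Union>u\<in>U. (\<lambda>C. SOME w. W_of C w) ` \<C>' u)"
  have U: "U_of C (SOME u. U_of C u)" if "C \<in> \<C>" for C
    using that unfolding \<C>_def by (auto intro: someI_ex)
  have W: "W_of C (SOME w. W_of C w)" if "C \<in> \<C>' u" for C u
    using that unfolding \<C>'_def by (auto intro: someI_ex)
  have fin: "finite \<C>" "finite (\<C>' u)" for u
    using components_finite by (auto simp: \<C>_def \<C>'_def)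
  then have finU: "finite U" and finW: "finite W'"
    by (auto simp: U_def W'_def)
  have "card \<C> \<le> card (components ?D)"
    unfolding \<C>_def using components_finite by (intro card_mono) auto
  also have "\<dots> \<le> component_bound q (d + 1)"
    using D v by (intro card_components) auto
  finally have "card \<C> \<le> component_bound q (d + 1)" .
  then have cardU: "card U \<le> component_bound q (d + 1)"
    unfolding U_def using card_image_le[OF fin(1)] le_trans by blast
  have "card ((\<lambda>C. SOME w. W_of C w) ` \<C>' u) \<le> component_bound q (d + 2)" for u
  proof -
    have "card (\<C>' u) \<le> card (components (insert u ?D))"
      unfolding \<C>'_def using components_finite by (intro card_mono) auto
    also have "\<dots> \<le> component_bound q (d + 2)"
      using D v by (intro card_components) (auto simp: card_insert_if)
    finally show ?thesis
      using card_image_le[OF fin(2)] le_trans by blast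
  qed
  then have "card W' \<le> card U * component_bound q (d + 2)"
    unfolding W'_def using card_UN_le[OF finU] sum_bounded_above[of U _ "component_bound q (d + 2)"]
    by (metis (no_types, lifting) le_trans of_nat_id)
  also have "\<dots> \<le> component_bound q (d + 1) * component_bound q (d + 2)"
    using cardU by simp
  finally have cardW: "card W' \<le> component_bound q (d + 1) * component_bound q (d + 2)" .
  show ?thesis
  proof (rule that[of "insert v (U \<union> W')"])
    show "insert v (U \<union> W') \<subseteq> ?K"
      using U W self_in_component unfolding U_def W'_def U_of_def W_of_def by auto
    show "finite (insert v (U \<union> W'))"
      using finU finW by simp
    have "card (insert v (U \<union> W')) \<le> Suc (card U + card W')"
      using card_insert_le_m1[of "Suc (card U + card W')" "U \<union> W'" v] card_Un_le[of U W'] by simp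
    then show "card (insert v (U \<union> W')) \<le> domination_bound q d"
      using cardU cardW unfolding domination_bound_def by linarith
    fix x
    assume xK: "x \<in> ?K"
    show "x \<in> insert v (U \<union> W') \<or> (\<exists>w\<in>insert v (U \<union> W'). E w x)"
    proof (cases "x = v \<or> E v x")
      case False
      have x: "x \<in> V" "x \<notin> ?D" "\<not> E v x"
        using xK v component_V component_notin False by auto
      have Kx: "component D x = ?K"
        using component_eq[OF xK] .
      let ?C = "component ?D x"
      have nadj: "\<not> E v y" if "y \<in> ?C" for y
        using component_insert_nonadjacent[OF that x(3)] .
      have "v \<notin> ?C"
        using component_notin[OF _ x(2)] by blast
      then obtain z u where "z \<in> ?C" "u \<in> ?K" "E z u" "u = v \<or> E v u"
        using component_insert_exit[OF x(2,3), of v] Kx self_in_component by metis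
      then have "U_of ?C u"
        unfolding U_of_def using nadj sym by blast
      moreover have "?C \<in> components ?D"
        using x by (auto simp: components_def)
      ultimately have C: "?C \<in> \<C>"
        unfolding \<C>_def by blast
      define t where "t = (SOME u. U_of ?C u)"
      have t: "t \<in> U" "U_of ?C t"
        using C U[OF C] by (auto simp: U_def t_def)
      then obtain y where y: "y \<in> ?C" "E t y" and tv: "E v t"
        unfolding U_of_def by blast
      show ?thesis
      proof (cases "E t x")
        case True
        then show ?thesis
          using t by blast
      next
        case False
        let ?C' = "component (insert t ?D) x"
        have "t \<noteq> x"
          using tv x by blast
        then have x': "x \<notin> insert t ?D"
          using x by blast
        have nadj': "\<not> E t y" if "y \<in> ?C'" for y
          using component_insert_nonadjacent[OF that False] .
        have "y \<notin> ?C'"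
          using y nadj' by blast
        then obtain z w where zw: "z \<in> ?C'" "w \<in> ?C" "E z w" "w = t \<or> E t w"
          using component_insert_exit[OF x' False y(1)] by metis
        then have "E t w"
          using nadj' sym by blast
        have sub: "?C' \<subseteq> ?C"
          by (rule component_insert_subset)
        have "E w y'" if y': "y' \<in> ?C'" for y'
        proof (rule ccontr)
          assume "\<not> E w y'"
          \<comment> \<open>A failure of completeness occurs at an edge \<open>s s'\<close> of the
            component, and \<open>v\<close>, \<open>t\<close>, \<open>w\<close>, \<open>s\<close>,
            \<open>s'\<close> is then an induced path.\<close>
          then obtain s s' where s: "s \<in> ?C'" "s' \<in> ?C'" "step (insert t ?D) s s'" "E w s" "\<not> E w s'"
            using component_boundary_edge[OF zw(1) y', where P = "E w"] zw(3) sym by metis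
          then show False
            using P5[of v t w s s'] tv \<open>E t w\<close> nadj nadj' sub zw(2) unfolding step_def by blast
        qed
        moreover have "w \<in> ?K"
          using zw(2) component_insert_subset[of v D x] Kx by blast
        ultimately have "W_of ?C' w"
          unfolding W_of_def by blast
        moreover have "?C' \<in> components (insert t ?D)"
          using x x' by (auto simp: components_def)
        ultimately have C': "?C' \<in> \<C>' t"
          unfolding \<C>'_def by blast
        then have "(SOME w. W_of ?C' w) \<in> W'"
          unfolding W'_def using t by blast
        moreover have "E (SOME w. W_of ?C' w) x"
          using W[OF C'] self_in_component unfolding W_of_def by blast
        ultimately show ?thesis
          by blast
      qed
    qed blast
  qed
qed

section \<open>Iterated refinement of \<open>D\<close>\<close>

lemma refine:
  assumes D: "D \<subseteq> V" "card D \<le> d"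
  obtains D' where "D \<subseteq> D'" "D' \<subseteq> V" "card D' \<le> refined_size q d"
    "\<And>x. x \<in> V - D' \<Longrightarrow> \<exists>w\<in>D' - D. E w x \<and> trace D w = trace D x"
proof -
  have finD: "finite D"
    using D finite_V finite_subset by blast
  have "\<exists>W. W \<subseteq> K \<and> finite W \<and> card W \<le> domination_bound q d \<and> (\<forall>x\<in>K. x \<in> W \<or> (\<exists>w\<in>W. E w x))"
    if "K \<in> components D" for K
  proof -
    obtain v where v: "v \<in> V - D" "K = component D v"
      using \<open>K \<in> components D\<close> unfolding components_def by blast
    then show ?thesis
      using component_dominated[OF v(1) finD D(2)] by metis
  qed
  then obtain W where W: "\<And>K. K \<in> components D \<Longrightarrow> W K \<subseteq> K \<and> finite (W K) \<and>
      card (W K) \<le> domination_bound q d \<and> (\<forall>x\<in>K. x \<in> W K \<or> (\<exists>w\<in>W K. E w x))"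
    by metis
  \<comment> \<open>A dominating vertex chosen inside the component of \<open>x\<close> has the same
    trace as \<open>x\<close>; this is what later extends the clique.\<close>
  let ?W = "\<Union>K\<in>components D. W K"
  have "card ?W \<le> (\<Sum>K\<in>components D. card (W K))"
    by (rule card_UN_le[OF components_finite])
  also have "\<dots> \<le> of_nat (card (components D)) * domination_bound q d"
    using W by (intro sum_bounded_above) blast
  also have "\<dots> \<le> component_bound q d * domination_bound q d"
    using card_components[OF finD D(2)] by simp
  finally have card: "card ?W \<le> component_bound q d * domination_bound q d" .
  show ?thesis
  proof (rule that[of "D \<union> ?W"])
    have "?W \<subseteq> V"
    proof
      fix x
      assume "x \<in> ?W"
      then obtain K where K: "K \<in> components D" "x \<in> W K"
        by blast
      then show "x \<in> V"
        using W[OF K(1)] component_V unfolding components_def by blast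
    qed
    with D show "D \<union> ?W \<subseteq> V"
      by blast
    show "card (D \<union> ?W) \<le> refined_size q d"
      using card_Un_le[of D ?W] card D(2) unfolding refined_size_def by linarith
    fix x
    assume x: "x \<in> V - (D \<union> ?W)"
    then have K: "component D x \<in> components D"
      unfolding components_def by blast
    moreover have "x \<notin> W (component D x)"
      using x K by blast
    ultimately obtain w where w: "w \<in> W (component D x)" "E w x"
      using W[OF K] self_in_component by blast
    then have "w \<in> component D x"
      using W[OF K] by blast
    then show "\<exists>w\<in>D \<union> ?W - D. E w x \<and> trace D w = trace D x"
      using w K x component_notin component_trace by (intro bexI[of _ w]) auto
  qed blast
qed

text \<open>The new vertex \<open>w\<close> is adjacent to \<open>x\<close> and has the same trace
  on the old \<open>D\<close>. It is therefore adjacent to all of the old clique \<open>Q\<close> of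
  neighbours of \<open>x\<close>, and \<open>insert w Q\<close> is a larger one.\<close>

lemma iterated_refinement:
  "\<exists>D\<subseteq>V. card D \<le> (refined_size q ^^ i) 0 \<and>
     (\<forall>x\<in>V - D. \<exists>Q\<subseteq>D. card Q = i \<and> clique Q \<and> (\<forall>y\<in>Q. E y x))"
proof (induction i)
  case 0
  show ?case
    by (intro exI[of _ "{}"]) (auto simp: clique_def)
next
  case (Suc i)
  then obtain D where D: "D \<subseteq> V" "card D \<le> (refined_size q ^^ i) 0"
    and Q: "\<And>x. x \<in> V - D \<Longrightarrow> \<exists>Q\<subseteq>D. card Q = i \<and> clique Q \<and> (\<forall>y\<in>Q. E y x)"
    by blast
  obtain D' where D': "D \<subseteq> D'" "D' \<subseteq> V" "card D' \<le> refined_size q ((refined_size q ^^ i) 0)"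
    and dom: "\<And>x. x \<in> V - D' \<Longrightarrow> \<exists>w\<in>D' - D. E w x \<and> trace D w = trace D x"
    using refine[OF D] by metis
  have "\<exists>Q\<subseteq>D'. card Q = Suc i \<and> clique Q \<and> (\<forall>y\<in>Q. E y x)" if x: "x \<in> V - D'" for x
  proof -
    obtain w where w: "w \<in> D' - D" "E w x" "trace D w = trace D x"
      using dom[OF x] by blast
    obtain Q where Q: "Q \<subseteq> D" "card Q = i" "clique Q" "\<forall>y\<in>Q. E y x"
      using Q[of x] x D' by blast
    have "E y w" if "y \<in> Q" for y
      using that Q trace_eqD[OF w(3)[symmetric]] by blast
    then have "clique (insert w Q)"
      using Q(3) sym unfolding clique_def by blast
    moreover have "card (insert w Q) = Suc i"
      using Q D w finite_V by (metis DiffD2 card_insert_disjoint finite_subset subsetD)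
    ultimately show ?thesis
      using Q w D' by (intro exI[of _ "insert w Q"]) auto
  qed
  with D' show ?case
    by (intro exI[of _ D']) auto
qed

text \<open>After \<open>q + 1\<close> rounds a vertex outside \<open>D\<close> would complete a
  clique of \<open>q + 2\<close> vertices.\<close>

theorem card_V_le: "card V \<le> (refined_size q ^^ (q + 1)) 0"
proof -
  obtain D where D: "D \<subseteq> V" "card D \<le> (refined_size q ^^ (q + 1)) 0"
    and Q: "\<And>x. x \<in> V - D \<Longrightarrow> \<exists>Q\<subseteq>D. card Q = q + 1 \<and> clique Q \<and> (\<forall>y\<in>Q. E y x)"
    using iterated_refinement[of "q + 1"] by blast
  have "V - D = {}"
  proof (rule ccontr)
    assume "V - D \<noteq> {}"
    then obtain x where x: "x \<in> V - D"
      by blast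
    then obtain Q where Q: "Q \<subseteq> D" "card Q = q + 1" "clique Q" "\<forall>y\<in>Q. E y x"
      using Q by blast
    then have "clique (insert x Q)"
      using sym unfolding clique_def by blast
    moreover have "card (insert x Q) = q + 2"
      using Q x D finite_V by (subst card_insert_disjoint) (auto intro: finite_subset)
    ultimately show False
      using clique_card[of "insert x Q"] Q D x by auto
  qed
  with D show ?thesis
    by (metis Diff_eq_empty_iff subset_antisym)
qed

end

section \<open>Pair graphs\<close>

text \<open>Arcs are pairs of ends, so an isomorphism is determined by its action on vertices.
  Subgraphs and isomorphisms can then be replaced by embeddings of vertex sets.\<close>

lemma induced_free_iff:
  assumes "pair_wf_digraph H" "pair_wf_digraph G"
  shows "induced_free (with_proj H) (with_proj G) \<longleftrightarrow>
    \<not> (\<exists>f. inj_on f (pverts H) \<and> f ` pverts H \<subseteq> pverts G \<and>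
          (\<forall>u\<in>pverts H. \<forall>v\<in>pverts H. (f u, f v) \<in> parcs G \<longleftrightarrow> (u, v) \<in> parcs H))"
    (is "_ \<longleftrightarrow> \<not> (\<exists>f. ?embedding f)")
proof -
  interpret H: pair_wf_digraph H by fact
  interpret G: pair_wf_digraph G by fact
  have wfG: "wf_digraph (with_proj G)"
    by (rule G.wf_digraph_axioms)
  have embeddingI: "\<exists>f. ?embedding f" if S: "induced_subgraph S (with_proj G)" "digraph_iso S (with_proj H)" for S
  proof -
    obtain h where h: "pre_digraph.digraph_isomorphism S h" "with_proj H = app_iso h S"
      using S(2) unfolding digraph_iso_def by blast
    have V: "verts S \<subseteq> pverts G" and A: "arcs S = {e \<in> parcs G. fst e \<in> verts S \<and> snd e \<in> verts S}"
      and ends: "tail S = fst" "head S = snd"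
      using S(1) unfolding induced_subgraph_def subgraph_def compatible_def by auto
    have VH: "pverts H = iso_verts h ` verts S" and AH: "parcs H = iso_arcs h ` arcs S"
      and ends': "iso_tail h = fst" "iso_head h = snd"
      using arg_cong[OF h(2), of verts] arg_cong[OF h(2), of arcs]
        arg_cong[OF h(2), of tail] arg_cong[OF h(2), of head] by simp_all
    have inj: "inj_on (iso_verts h) (verts S)"
      and arc: "\<And>a. a \<in> arcs S \<Longrightarrow> iso_arcs h a = (iso_verts h (fst a), iso_verts h (snd a))"
      using h(1) ends ends' unfolding pre_digraph.digraph_isomorphism_def by (auto simp: prod_eq_iff)
    \<comment> \<open>The isomorphism leads from the subgraph to \<open>H\<close>; the embedding is
      its inverse.\<close>
    define f where "f = the_inv_into (verts S) (iso_verts h)"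
    have f: "f (iso_verts h x) = x" if "x \<in> verts S" for x
      using the_inv_into_f_f[OF inj that] by (simp add: f_def)
    have "(x, y) \<in> parcs G \<longleftrightarrow> (iso_verts h x, iso_verts h y) \<in> parcs H"
      if "x \<in> verts S" "y \<in> verts S" for x y
    proof
      assume "(x, y) \<in> parcs G"
      then have "(x, y) \<in> arcs S"
        using A that by simp
      then show "(iso_verts h x, iso_verts h y) \<in> parcs H"
        unfolding AH using arc by force
    next
      assume "(iso_verts h x, iso_verts h y) \<in> parcs H"
      then obtain a where "a \<in> arcs S" "(iso_verts h x, iso_verts h y) = iso_arcs h a"
        unfolding AH by blast
      then show "(x, y) \<in> parcs G"
        using arc[of a] A that by (cases a) (auto simp: inj_on_eq_iff[OF inj])
    qed
    then have "?embedding f"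
      using V f unfolding VH by (auto simp: inj_on_def)
    then show ?thesis
      by blast
  qed
  have subgraphI: "\<exists>S. induced_subgraph S (with_proj G) \<and> digraph_iso S (with_proj H)"
    if f: "?embedding f" for f
  proof -
    define S where "S = with_proj \<lparr>pverts = f ` pverts H,
      parcs = {e \<in> parcs G. fst e \<in> f ` pverts H \<and> snd e \<in> f ` pverts H}\<rparr>"
    define g where "g = the_inv_into (pverts H) f"
    have g: "g (f u) = u" if "u \<in> pverts H" for u
      using f that by (simp add: g_def the_inv_into_f_f)
    have S: "verts S = f ` pverts H" "tail S = fst" "head S = snd"
      "arcs S = {e \<in> parcs G. fst e \<in> f ` pverts H \<and> snd e \<in> f ` pverts H}"
      by (simp_all add: S_def)
    have wfS: "wf_digraph S"
      by unfold_locales (auto simp: S)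
    then have ind: "induced_subgraph S (with_proj G)"
      unfolding induced_subgraph_def subgraph_def compatible_def using wfG f by (auto simp: S)
    define h where "h = \<lparr>iso_verts = g, iso_arcs = map_prod g g, iso_head = snd, iso_tail = fst\<rparr>"
    have "inj_on g (verts S)"
      unfolding S inj_on_def using g by auto
    moreover have "inj_on (map_prod g g) (arcs S)"
      unfolding S inj_on_def using g by (auto simp: prod_eq_iff)
    ultimately have "pre_digraph.digraph_isomorphism S h"
      unfolding pre_digraph.digraph_isomorphism_def using wfS by (auto simp: h_def S)
    moreover have "with_proj H = app_iso h S"
    proof (rule pre_digraph.equality)
      show "verts (with_proj H) = verts (app_iso h S)"
        using g by (force simp: h_def S)
      have "(u, v) \<in> map_prod g g ` arcs S" if "(u, v) \<in> parcs H" for u v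
        using that f g H.wellformed' by (intro image_eqI[of _ _ "(f u, f v)"]) (auto simp: S)
      moreover have "map_prod g g a \<in> parcs H" if "a \<in> arcs S" for a
        using that f g by (cases a) (auto simp: S)
      ultimately show "arcs (with_proj H) = arcs (app_iso h S)"
        by (auto simp: h_def)
    qed (simp_all add: h_def)
    ultimately show ?thesis
      using ind unfolding digraph_iso_def by blast
  qed
  have "(\<exists>S. induced_subgraph S (with_proj G) \<and> digraph_iso S (with_proj H)) \<longleftrightarrow> (\<exists>f. ?embedding f)"
  proof
    assume "\<exists>S. induced_subgraph S (with_proj G) \<and> digraph_iso S (with_proj H)"
    then show "\<exists>f. ?embedding f"
      by (elim exE conjE) (rule embeddingI)
  next
    assume "\<exists>f. ?embedding f"
    then show "\<exists>S. induced_subgraph S (with_proj G) \<and> digraph_iso S (with_proj H)"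
      by (elim exE) (rule subgraphI)
  qed
  then show ?thesis
    unfolding induced_free_def by (rule arg_cong)
qed

lemma vertex_critical_iff:
  assumes "pair_wf_digraph G"
  defines "E \<equiv> \<lambda>u v. (u, v) \<in> parcs G"
  shows "vertex_critical k (with_proj G) \<longleftrightarrow>
    (LEAST n. colourable E (pverts G) n) = k \<and>
    (\<forall>v\<in>pverts G. (LEAST n. colourable E (pverts G - {v}) n) < k)"
proof -
  interpret pair_wf_digraph G by fact
  have "(\<exists>c. proper_colouring (with_proj G) n c) \<longleftrightarrow> colourable E (pverts G) n" for n
    unfolding proper_colouring_def colourable_def E_def using wellformed'
    by (intro ex_cong1 conj_cong) auto
  moreover have "(\<exists>c. proper_colouring (pre_digraph.del_vert (with_proj G) v) n c) \<longleftrightarrow>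
      colourable E (pverts G - {v}) n" for v n
  proof -
    have "u \<rightarrow>\<^bsub>pre_digraph.del_vert (with_proj G) v\<^esub> w \<longleftrightarrow> E u w \<and> u \<noteq> v \<and> w \<noteq> v" for u w
      by (force simp: arcs_ends_conv del_vert_simps E_def)
    moreover have "E u w \<Longrightarrow> u \<in> pverts G \<and> w \<in> pverts G" for u w
      using wellformed' by (auto simp: E_def)
    ultimately show ?thesis
      unfolding proper_colouring_def colourable_def verts_del_vert with_proj_simps
      by (intro ex_cong1 conj_cong) auto
  qed
  ultimately show ?thesis
    unfolding vertex_critical_def chromatic_number_def by simp
qed

lemma colourable_mono: "colourable E A m \<Longrightarrow> m \<le> n \<Longrightarrow> colourable E A n"
  unfolding colourable_def by (meson order.strict_trans2)

lemma pair_wf_digraph_path_wheel: "pair_wf_digraph (path_graph 5)" "pair_wf_digraph (wheel_graph 4)"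
proof -
  interpret P: pair_graph "path_graph 5"
    by (rule pair_graph_path_graph)
  interpret W: pair_graph "wheel_graph 4"
    by (rule pair_graph_wheel_graph) simp
  show "pair_wf_digraph (path_graph 5)" "pair_wf_digraph (wheel_graph 4)"
    by unfold_locales
qed

text \<open>Since \<open>k\<close> is positive, \<open>k - 1\<close> lies below the least number of
  colours for the whole graph, while a least number below \<open>k\<close> is at most
  \<open>k - 1\<close>.\<close>

lemma critical_P5_W4_free_pair_graph:
  assumes "k \<ge> 1" "pair_graph G" "vertex_critical k (with_proj G)"
    and P5_free: "induced_free (with_proj (path_graph 5)) (with_proj G)"
    and W4_free: "induced_free (with_proj (wheel_graph 4)) (with_proj G)"
  shows "critical_P5_W4_free (pverts G) (\<lambda>u v. (u, v) \<in> parcs G) (k - 1)"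
proof -
  interpret pair_graph G by fact
  let ?E = "\<lambda>u v. (u, v) \<in> parcs G"
  have wf: "pair_wf_digraph G"
    by unfold_locales
  have sym: "?E u v \<Longrightarrow> ?E v u" for u v
    using pair_sym_arcs by (auto simp: symmetric_def dest: symD)
  have irrefl: "\<not> ?E u u" for u
    using pair_no_loops by fastforce
  have crit: "(LEAST n. colourable ?E (pverts G) n) = k"
    "\<And>v. v \<in> pverts G \<Longrightarrow> (LEAST n. colourable ?E (pverts G - {v}) n) < k"
    using assms(3) unfolding vertex_critical_iff[OF wf] by auto
  show ?thesis
  proof
    show "finite (pverts G)"
      by (rule pair_finite_verts)
    show "?E x y \<Longrightarrow> x \<in> pverts G" for x y
      using wellformed' by blast
    show "?E x y \<Longrightarrow> ?E y x" for x y
      by (rule sym)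
    show "\<not> ?E x x" for x
      by (rule irrefl)
    show "\<not> colourable ?E (pverts G) (k - 1)"
      using not_less_Least[of "k - 1" "colourable ?E (pverts G)"] crit(1) assms(1) by simp
    fix v
    assume v: "v \<in> pverts G"
    \<comment> \<open>A numbering of the vertices is a proper colouring, so the least number of
      colours is attained.\<close>
    obtain e where e: "bij_betw e (pverts G) {0..<card (pverts G)}"
      using ex_bij_betw_finite_nat[OF pair_finite_verts] by blast
    have "colourable ?E (pverts G - {v}) (card (pverts G))"
      unfolding colourable_def
    proof (intro exI conjI ballI impI)
      fix u
      assume u: "u \<in> pverts G - {v}"
      then show "e u < card (pverts G)"
        using bij_betwE[OF e] by simp
      fix w
      assume w: "w \<in> pverts G - {v}" "?E u w"
      then show "e u \<noteq> e w"
        using u irrefl bij_betw_imp_inj_on[OF e] by (metis DiffD1 inj_onD)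
    qed
    then have "colourable ?E (pverts G - {v}) (LEAST n. colourable ?E (pverts G - {v}) n)"
      by (rule LeastI)
    then show "colourable ?E (pverts G - {v}) (k - 1)"
      by (rule colourable_mono) (use crit(2)[OF v] in simp)
  next
    fix a b c d e
    assume edges: "?E a b" "?E b c" "?E c d" "?E d e"
      and nonedges: "\<not> ?E a c" "\<not> ?E a d" "\<not> ?E a e" "\<not> ?E b d" "\<not> ?E b e" "\<not> ?E c e"
    have nonedges': "\<not> ?E c a" "\<not> ?E d a" "\<not> ?E e a" "\<not> ?E d b" "\<not> ?E e b" "\<not> ?E e c"
      using nonedges sym by blast+
    have distinct: "distinct [a, b, c, d, e]"
      using edges nonedges nonedges' irrefl by auto
    let ?f = "\<lambda>i. [a, b, c, d, e] ! i"
    have verts: "pverts (path_graph 5) = {0, 1, 2, 3, 4}"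
      by (auto simp: path_graph_def)
    have "inj_on ?f (pverts (path_graph 5))"
      unfolding path_graph_def by (intro inj_on_nth[OF distinct]) auto
    moreover have "?f ` pverts (path_graph 5) \<subseteq> pverts G"
      using edges wellformed' by (auto simp: verts)
    moreover have "\<forall>u\<in>pverts (path_graph 5). \<forall>v\<in>pverts (path_graph 5).
        (?f u, ?f v) \<in> parcs G \<longleftrightarrow> (u, v) \<in> parcs (path_graph 5)"
      unfolding verts by (simp add: path_graph_def edges edges[THEN sym] nonedges nonedges' irrefl)
    ultimately show False
      using P5_free unfolding induced_free_iff[OF pair_wf_digraph_path_wheel(1) wf] by blast
  next
    fix a b c d h
    assume edges: "?E a b" "?E b c" "?E c d" "?E d a" "?E h a" "?E h b" "?E h c" "?E h d"
      and nonedges: "\<not> ?E a c" "\<not> ?E b d" "a \<noteq> c" "b \<noteq> d"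
    have nonedges': "\<not> ?E c a" "\<not> ?E d b"
      using nonedges sym by blast+
    have distinct: "distinct [a, b, c, d, h]"
      using edges nonedges irrefl by auto
    let ?f = "\<lambda>i. [a, b, c, d, h] ! i"
    have verts: "pverts (wheel_graph 4) = {0, 1, 2, 3, 4}"
      by (auto simp: wheel_graph_def cycle_graph_def)
    have "inj_on ?f (pverts (wheel_graph 4))"
      unfolding verts by (intro inj_on_nth[OF distinct]) auto
    moreover have "?f ` pverts (wheel_graph 4) \<subseteq> pverts G"
      using edges wellformed' by (auto simp: verts)
    moreover have "\<forall>u\<in>pverts (wheel_graph 4). \<forall>v\<in>pverts (wheel_graph 4).
        (?f u, ?f v) \<in> parcs G \<longleftrightarrow> (u, v) \<in> parcs (wheel_graph 4)"
      unfolding verts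
      by (simp add: wheel_graph_def cycle_graph_def edges edges[THEN sym] nonedges nonedges' irrefl)
    ultimately show False
      using W4_free unfolding induced_free_iff[OF pair_wf_digraph_path_wheel(2) wf] by blast
  qed
qed

section \<open>Isomorphic copies on the natural numbers\<close>

lemma colourable_image_iff:
  assumes "inj_on f A" "\<And>u v. u \<in> A \<Longrightarrow> v \<in> A \<Longrightarrow> E' (f u) (f v) \<longleftrightarrow> E u v"
  shows "colourable E' (f ` A) n \<longleftrightarrow> colourable E A n"
proof
  assume "colourable E' (f ` A) n"
  then obtain c where c: "\<forall>v\<in>f ` A. c v < n" "\<forall>u\<in>f ` A. \<forall>v\<in>f ` A. E' u v \<longrightarrow> c u \<noteq> c v"
    unfolding colourable_def by blast
  then show "colourable E A n"
    unfolding colourable_def using assms(2) by (intro exI[of _ "c \<circ> f"]) auto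
next
  assume "colourable E A n"
  then obtain c where c: "\<forall>v\<in>A. c v < n" "\<forall>u\<in>A. \<forall>v\<in>A. E u v \<longrightarrow> c u \<noteq> c v"
    unfolding colourable_def by blast
  then show "colourable E' (f ` A) n"
    unfolding colourable_def using assms
    by (intro exI[of _ "c \<circ> the_inv_into A f"]) (auto simp: the_inv_into_f_f)
qed

definition image_graph :: "('a \<Rightarrow> 'b) \<Rightarrow> 'a pair_pre_digraph \<Rightarrow> 'b pair_pre_digraph" where
  "image_graph f G = \<lparr>pverts = f ` pverts G, parcs = map_prod f f ` parcs G\<rparr>"

context
  fixes f :: "'a \<Rightarrow> 'b" and G :: "'a pair_pre_digraph"
  assumes G: "pair_graph G" and inj: "inj_on f (pverts G)"
begin

interpretation pair_graph G
  by (rule G)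

lemma image_graph_arc_iff:
  assumes "u \<in> pverts G" "v \<in> pverts G"
  shows "(f u, f v) \<in> parcs (image_graph f G) \<longleftrightarrow> (u, v) \<in> parcs G"
proof
  assume "(f u, f v) \<in> parcs (image_graph f G)"
  then obtain x y where "(x, y) \<in> parcs G" "f u = f x" "f v = f y"
    unfolding image_graph_def by auto
  then show "(u, v) \<in> parcs G"
    using inj_onD[OF inj] assms wellformed' by metis
qed (force simp: image_graph_def)

lemma pair_graph_image_graph: "pair_graph (image_graph f G)"
proof
  show "symmetric (with_proj (image_graph f G))"
    using pair_sym_arcs unfolding symmetric_def image_graph_def by (auto intro!: symI dest: symD)
  show "fst e \<noteq> snd e" if "e \<in> parcs (image_graph f G)" for e
    using that wellformed' inj pair_no_loops unfolding image_graph_def by (fastforce dest: inj_onD)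
qed (use wellformed' pair_finite_verts pair_finite_arcs in \<open>auto simp: image_graph_def\<close>)

lemma digraph_iso_image_graph: "digraph_iso (with_proj G) (with_proj (image_graph f G))"
proof -
  let ?h = "\<lparr>iso_verts = f, iso_arcs = map_prod f f, iso_head = snd, iso_tail = fst\<rparr>"
  have "inj_on (map_prod f f) (parcs G)"
    by (rule inj_on_subset[OF map_prod_inj_on[OF inj inj]]) (use wellformed' in auto)
  then have "digraph_isomorphism ?h"
    unfolding digraph_isomorphism_def using inj wf_digraph_axioms by simp
  moreover have "with_proj (image_graph f G) = app_iso ?h (with_proj G)"
    by (simp add: image_graph_def app_iso_def with_proj_def)
  ultimately show ?thesis
    unfolding digraph_iso_def by blast
qed

lemma vertex_critical_image_graph:
  "vertex_critical k (with_proj (image_graph f G)) \<longleftrightarrow> vertex_critical k (with_proj G)"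
proof -
  interpret H: pair_graph "image_graph f G"
    by (rule pair_graph_image_graph)
  have "colourable (\<lambda>u v. (u, v) \<in> parcs (image_graph f G)) (f ` A) =
      colourable (\<lambda>u v. (u, v) \<in> parcs G) A" if "A \<subseteq> pverts G" for A
    using that inj image_graph_arc_iff
    by (intro ext colourable_image_iff) (auto intro: inj_on_subset)
  moreover have "pverts (image_graph f G) - {f v} = f ` (pverts G - {v})" if "v \<in> pverts G" for v
    using that inj unfolding image_graph_def by (auto dest: inj_onD)
  moreover have "pverts (image_graph f G) = f ` pverts G"
    by (simp add: image_graph_def)
  ultimately show ?thesis
    unfolding vertex_critical_iff[OF pair_wf_digraph_axioms]
      vertex_critical_iff[OF H.pair_wf_digraph_axioms] by auto
qed

lemma induced_free_image_graph:
  assumes "pair_wf_digraph H" "induced_free (with_proj H) (with_proj G)"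
  shows "induced_free (with_proj H) (with_proj (image_graph f G))"
proof -
  interpret I: pair_graph "image_graph f G"
    by (rule pair_graph_image_graph)
  let ?g = "the_inv_into (pverts G) f"
  have g: "?g (f v) = v" if "v \<in> pverts G" for v
    using inj that by (rule the_inv_into_f_f)
  show ?thesis
    unfolding induced_free_iff[OF assms(1) I.pair_wf_digraph_axioms]
  proof (rule notI, elim exE conjE)
    fix h
    assume h: "inj_on h (pverts H)" "h ` pverts H \<subseteq> pverts (image_graph f G)"
      "\<forall>u\<in>pverts H. \<forall>v\<in>pverts H. (h u, h v) \<in> parcs (image_graph f G) \<longleftrightarrow> (u, v) \<in> parcs H"
    have gh: "?g (h u) \<in> pverts G" "f (?g (h u)) = h u" if "u \<in> pverts H" for u
      using that h(2) g unfolding image_graph_def by fastforce+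
    have "((?g \<circ> h) u, (?g \<circ> h) v) \<in> parcs G \<longleftrightarrow> (u, v) \<in> parcs H"
      if "u \<in> pverts H" "v \<in> pverts H" for u v
      using image_graph_arc_iff[of "?g (h u)" "?g (h v)"] gh that h(3) by simp
    moreover have "inj_on (?g \<circ> h) (pverts H)"
      using gh(2) h(1) unfolding inj_on_def comp_def by metis
    moreover have "(?g \<circ> h) ` pverts H \<subseteq> pverts G"
      using gh(1) by auto
    ultimately show False
      using spec[OF assms(2)[unfolded induced_free_iff[OF assms(1) pair_wf_digraph_axioms] not_ex],
          of "?g \<circ> h"] by simp
  qed
qed

end

lemma finite_pair_graphs_on:
  assumes "finite A"
  shows "finite {H. pair_graph H \<and> pverts H \<subseteq> A}"
proof (rule finite_subset)
  show "{H. pair_graph H \<and> pverts H \<subseteq> A} \<subseteq>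
      (\<lambda>(V, R). \<lparr>pverts = V, parcs = R\<rparr>) ` (Pow A \<times> Pow (A \<times> A))"
  proof
    fix H
    assume "H \<in> {H. pair_graph H \<and> pverts H \<subseteq> A}"
    then have "pair_graph H" "pverts H \<subseteq> A"
      by auto
    then interpret pair_graph H
      by simp
    have "parcs H \<subseteq> A \<times> A"
      using wellformed' \<open>pverts H \<subseteq> A\<close> by auto
    with \<open>pverts H \<subseteq> A\<close> show "H \<in> (\<lambda>(V, R). \<lparr>pverts = V, parcs = R\<rparr>) ` (Pow A \<times> Pow (A \<times> A))"
      by (intro image_eqI[of _ _ "(pverts H, parcs H)"]) auto
  qed
qed (use assms in simp)

theorem theorem1p1:
  fixes k :: nat
  assumes "k \<ge> 1"
  shows "\<exists>F :: nat pair_pre_digraph set.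
           finite F \<and>
           (\<forall>H \<in> F. pair_graph H \<and> vertex_critical k (with_proj H) \<and>
              induced_free (with_proj (path_graph 5)) (with_proj H) \<and>
              induced_free (with_proj (wheel_graph 4)) (with_proj H)) \<and>
           (\<forall>G :: 'a pair_pre_digraph.
              pair_graph G \<and> vertex_critical k (with_proj G) \<and>
              induced_free (with_proj (path_graph 5)) (with_proj G) \<and>
              induced_free (with_proj (wheel_graph 4)) (with_proj G) \<longrightarrow>
              (\<exists>H \<in> F. digraph_iso (with_proj G) (with_proj H)))"
proof -
  \<comment> \<open>This is the bound of \<open>card_V_le\<close> with \<open>q\<close> equal to
    \<open>k - 1\<close>.\<close>
  define B where "B = (refined_size (k - 1) ^^ (k - 1 + 1)) 0"
  \<comment> \<open>All suitable graphs with vertices below \<open>B\<close> are taken, isomorphic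
    copies included; each \<open>G\<close> is carried into \<open>F\<close> by a numbering of its
    vertices.\<close>
  define F :: "nat pair_pre_digraph set" where
    "F = {H \<in> {H. pair_graph H \<and> pverts H \<subseteq> {..<B}}. vertex_critical k (with_proj H) \<and>
              induced_free (with_proj (path_graph 5)) (with_proj H) \<and>
              induced_free (with_proj (wheel_graph 4)) (with_proj H)}"
  have "\<exists>H\<in>F. digraph_iso (with_proj G) (with_proj H)"
    if G: "pair_graph G" "vertex_critical k (with_proj G)"
      "induced_free (with_proj (path_graph 5)) (with_proj G)"
      "induced_free (with_proj (wheel_graph 4)) (with_proj G)" for G :: "'a pair_pre_digraph"
  proof -
    interpret critical_P5_W4_free "pverts G" "\<lambda>u v. (u, v) \<in> parcs G" "k - 1"
      by (rule critical_P5_W4_free_pair_graph[OF assms G])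
    obtain f where f: "bij_betw f (pverts G) {0..<card (pverts G)}"
      using ex_bij_betw_finite_nat[OF finite_V] by blast
    then have inj: "inj_on f (pverts G)"
      by (rule bij_betw_imp_inj_on)
    have "pverts (image_graph f G) \<subseteq> {..<B}"
      using bij_betw_imp_surj_on[OF f] card_V_le by (auto simp: image_graph_def B_def)
    then have "image_graph f G \<in> F"
      unfolding F_def using pair_graph_image_graph[OF G(1) inj] G(2-4)
        vertex_critical_image_graph[OF G(1) inj] induced_free_image_graph[OF G(1) inj pair_wf_digraph_path_wheel(1)]
        induced_free_image_graph[OF G(1) inj pair_wf_digraph_path_wheel(2)] by blast
    then show ?thesis
      using digraph_iso_image_graph[OF G(1) inj] by blast
  qed
  moreover have "finite F"
    unfolding F_def by (intro finite_Collect_conjI disjI1 finite_subset[OF _ finite_pair_graphs_on[of "{..<B}"]]) auto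
  ultimately show ?thesis
    by (intro exI[of _ F]) (auto simp: F_def)
qed

end
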